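(* The optimal sampled-data controls $u^*_h$, $h\in\Delta$, converge pointwise on $[a,b)$ to the optimal permanent control $u^*$ as $\Vert h\Vert_\Delta$ tends to $0$. That is, for every $t\in[a,b)$ and every $\varepsilon>0$ there exists $\delta>0$ such that $\Vert u^*_h(t)-u^*(t)\Vert_{\mathbb{R}^m}<\varepsilon$ for every $h\in\Delta$ with $\Vert h\Vert_\Delta<\delta$.
   Context: Let $m,n\ge 1$ be integers and $a<b$ real numbers. Let $q_a,q_b\in\mathbb{R}^n$, let $S\in\mathbb{R}^{n\times n}$ be symmetric positive-semidefinite, let $x,\omega:[a,b]\to\mathbb{R}^n$ and $v:[a,b]\to\mathbb{R}^m$ be continuous, and let $A:[a,b]\to\mathbb{R}^{n\times n}$, $B:[a,b]\to\mathbb{R}^{n\times m}$, $W:[a,b]\to\mathbb{R}^{n\times n}$, $R:[a,b]\to\mathbb{R}^{m\times m}$ be continuous, with $W(t)$ symmetric positive-semidefinite and $R(t)$ symmetric positive-definite for every $t\in[a,b]$. For $u\in L^2:=L^2([a,b],\mathbb{R}^m)$, let $q(\cdot,u)$ denote the unique absolutely continuous solution on $[a,b]$ of $\dot q(t)=A(t)q(t)+B(t)u(t)+\omega(t)$ for a.e. $t\in[a,b]$, $q(a)=q_a$. Define the cost $$C(u):=\tfrac12\langle S(q(b,u)-q_b),q(b,u)-q_b\rangle+\tfrac12\int_a^b\Big(\langle W(\tau)(q(\tau,u)-x(\tau)),q(\tau,u)-x(\tau)\rangle+\langle R(\tau)(u(\tau)-v(\tau)),u(\tau)-v(\tau)\rangle\Big)d\tau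 .$$ The optimal permanent control $u^*$ is the unique minimizer of $C$ over $L^2$; it is equal almost everywhere to a continuous function on $[a,b]$, and $u^*$ denotes this continuous representative. Let $\Delta:=\bigcup_{N\ge1}\{h=(h_i)_{i=0,\dots,N-1}\in(0,+\infty)^N:\sum_{i=0}^{N-1}h_i=b-a\}$. For $h\in\Delta$ of length $N$, let $\Vert h\Vert_\Delta:=\max_{0\le i\le N-1}h_i$ and $s^h_i:=a+\sum_{j=0}^{i-1}h_j$ for $i=0,\dots,N$. Let $E_h\subset L^2$ be the set of functions $u:[a,b)\to\mathbb{R}^m$ that are constant on each interval $[s^h_i,s^h_{i+1})$, $i=0,\dots,N-1$. The optimal sampled-data control $u^*_h\in E_h$ is the unique minimizer of $C$ over $E_h$ (existence and uniqueness of the minimizers over $L^2$ and over $E_h$ are standard). *)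

theory Defs
  imports "HOL-Analysis.Analysis"
begin

definition sym_pos_semidef :: "real ^ 'n ^ 'n \<Rightarrow> bool" where
  "sym_pos_semidef M \<longleftrightarrow> transpose M = M \<and> (\<forall>y. 0 \<le> (M *v y) \<bullet> y)"

definition sym_pos_def :: "real ^ 'n ^ 'n \<Rightarrow> bool" where
  "sym_pos_def M \<longleftrightarrow> transpose M = M \<and> (\<forall>y. y \<noteq> 0 \<longrightarrow> 0 < (M *v y) \<bullet> y)"

text \<open>
  Square-integrable functions are represented by total functions on the reals of which only the
  values on \<open>{a..b}\<close> matter; almost-everywhere equal functions are not identified.
\<close>

definition L2_on :: "real \<Rightarrow> real \<Rightarrow> (real \<Rightarrow> 'e::euclidean_space) set" where
  "L2_on a b = {u. u \<in> borel_measurable (lebesgue_on {a..b}) \<and>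
                   integrable (lebesgue_on {a..b}) (\<lambda>t. (norm (u t))\<^sup>2)}"

text \<open>
  The usual \<open>\<epsilon>\<close>-\<open>\<delta>\<close> notion for functions of one real variable. (The constant
  \<^const>\<open>absolutely_continuous\<close> of the library is the unrelated relation between measures.)
  A finite family \<open>d\<close> with \<open>d division_of \<Union>d\<close> consists of compact intervals with pairwise
  disjoint interiors; \<open>Inf k\<close> and \<open>Sup k\<close> are the endpoints of the interval \<open>k\<close>.
\<close>

definition abs_continuous_on :: "real set \<Rightarrow> (real \<Rightarrow> 'e::real_normed_vector) \<Rightarrow> bool" where
  "abs_continuous_on X f \<longleftrightarrow>
     (\<forall>\<epsilon>>0. \<exists>\<delta>>0. \<forall>d. d division_of \<Union>d \<and> \<Union>d \<subseteq> X \<and> (\<Sum>k\<in>d. Sup k - Inf k) < \<delta> \<longrightarrow>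
        (\<Sum>k\<in>d. norm (f (Sup k) - f (Inf k))) < \<epsilon>)"

definition is_state ::
  "real \<Rightarrow> real \<Rightarrow> (real \<Rightarrow> real ^ 'n ^ 'n) \<Rightarrow> (real \<Rightarrow> real ^ 'm ^ 'n) \<Rightarrow> (real \<Rightarrow> real ^ 'n) \<Rightarrow>
   real ^ 'n \<Rightarrow> (real \<Rightarrow> real ^ 'm) \<Rightarrow> (real \<Rightarrow> real ^ 'n) \<Rightarrow> bool" where
  "is_state a b A B \<omega> qa u q \<longleftrightarrow>
     abs_continuous_on {a..b} q \<and>
     (AE t in lebesgue_on {a..b}.
        (q has_vector_derivative (A t *v q t + B t *v u t + \<omega> t)) (at t within {a..b})) \<and>
     q a = qa"

text \<open>
  Solutions are unique on \<open>{a..b}\<close> only, so the value outside of this interval is fixed by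
  extensionality to make the description definite.
\<close>

definition state ::
  "real \<Rightarrow> real \<Rightarrow> (real \<Rightarrow> real ^ 'n ^ 'n) \<Rightarrow> (real \<Rightarrow> real ^ 'm ^ 'n) \<Rightarrow> (real \<Rightarrow> real ^ 'n) \<Rightarrow>
   real ^ 'n \<Rightarrow> (real \<Rightarrow> real ^ 'm) \<Rightarrow> real \<Rightarrow> real ^ 'n" where
  "state a b A B \<omega> qa u = (THE q. q \<in> extensional {a..b} \<and> is_state a b A B \<omega> qa u q)"

definition cost ::
  "real \<Rightarrow> real \<Rightarrow> (real \<Rightarrow> real ^ 'n ^ 'n) \<Rightarrow> (real \<Rightarrow> real ^ 'm ^ 'n) \<Rightarrow> (real \<Rightarrow> real ^ 'n) \<Rightarrow>
   real ^ 'n \<Rightarrow> real ^ 'n \<Rightarrow> real ^ 'n ^ 'n \<Rightarrow> (real \<Rightarrow> real ^ 'n ^ 'n) \<Rightarrow> (real \<Rightarrow> real ^ 'm ^ 'm) \<Rightarrow>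
   (real \<Rightarrow> real ^ 'n) \<Rightarrow> (real \<Rightarrow> real ^ 'm) \<Rightarrow> (real \<Rightarrow> real ^ 'm) \<Rightarrow> real" where
  "cost a b A B \<omega> qa qb S W R x v u =
     (let q = state a b A B \<omega> qa u in
      1/2 * ((S *v (q b - qb)) \<bullet> (q b - qb)) +
      1/2 * (\<integral>t. (W t *v (q t - x t)) \<bullet> (q t - x t) + (R t *v (u t - v t)) \<bullet> (u t - v t)
               \<partial>lebesgue_on {a..b}))"

text \<open>A partition is the list of its step lengths \<open>[h\<^sub>0, \<dots>, h\<^sub>N\<^sub>-\<^sub>1]\<close> with \<open>N \<ge> 1\<close>.\<close>

definition partitions :: "real \<Rightarrow> real \<Rightarrow> real list set" where
  "partitions a b = {h. h \<noteq> [] \<and> (\<forall>i<length h. 0 < h ! i) \<and> (\<Sum>i<length h. h ! i) = b - a}"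

definition mesh :: "real list \<Rightarrow> real" where
  "mesh h = Max (set h)"

definition sample_time :: "real \<Rightarrow> real list \<Rightarrow> nat \<Rightarrow> real" where
  "sample_time a h i = a + (\<Sum>j<i. h ! j)"

text \<open>
  For \<open>h \<in> partitions a b\<close> these are the functions that are piecewise constant on \<open>{a..<b}\<close>;
  they automatically belong to \<open>L2_on a b\<close>.
\<close>

definition sampled_controls :: "real \<Rightarrow> real list \<Rightarrow> (real \<Rightarrow> 'e) set" where
  "sampled_controls a h =
     {u. \<forall>i<length h. u constant_on {sample_time a h i..<sample_time a h (Suc i)}}"

end

theory Submission
  imports Defs
begin

text \<open>
  The cost is a quadratic functional of the control whose Hessian is bounded below by
  \<open>r \<parallel>w\<parallel>\<^sup>2\<close> in \<open>L\<^sup>2\<close>. Let \<open>e\<close> be the difference between the sampled and the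
  permanent optimum. Stationarity of both shows that \<open>e\<close> is Hessian-orthogonal to all sampled
  controls, and minimality shows that its Hessian is at most that of \<open>d\<close>, the difference
  between the sample-and-hold of the permanent optimum and the permanent optimum. As the permanent
  optimum is uniformly continuous, \<open>d\<close> is uniformly small and hence \<open>e\<close> is small in
  \<open>L\<^sup>2\<close>. Testing the orthogonality with the constant \<open>e(t)\<close> on the sampling interval of
  \<open>t\<close>, the part of the Hessian that acts through the state is at most
  \<open>K \<parallel>e\<parallel>\<^sub>1\<close> times the length of the interval, which leaves a pointwise estimate of \<open>e(t)\<close>.
  No adjoint state is needed.

  All controls that occur are piecewise continuous, so the states are solutions of an integral
  equation, for which existence and uniqueness are elementary.
\<close>

subsection \<open>Piecewise continuous functions\<close>

text \<open>Boundedness takes the place of one-sided limits at the exceptional points: with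
  continuity off a finite set it yields Lebesgue integrability, and both properties pass easily to
  sums, bilinear products and subintervals. The class contains the continuous controls as well as
  all sampled controls.\<close>

definition pw_continuous :: "real \<Rightarrow> real \<Rightarrow> (real \<Rightarrow> 'e::real_normed_vector) \<Rightarrow> bool" where
  "pw_continuous a b f \<longleftrightarrow>
     bounded (f ` {a..b}) \<and> (\<exists>F. finite F \<and> continuous_on ({a..b} - F) f)"

lemma pw_continuousI:
  assumes "\<And>t. t \<in> {a..b} \<Longrightarrow> norm (f t) \<le> M"
    and "finite F" "continuous_on ({a..b} - F) f"
  shows "pw_continuous a b f"
  using assms unfolding pw_continuous_def bounded_iff by blast

lemma pw_continuousE:
  assumes "pw_continuous a b f"
  obtains M F where "0 < M" "\<forall>t\<in>{a..b}. norm (f t) \<le> M"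
    "finite F" "continuous_on ({a..b} - F) f"
  using assms unfolding pw_continuous_def bounded_pos by fastforce

lemma continuous_imp_pw_continuous:
  "continuous_on {a..b} f \<Longrightarrow> pw_continuous a b f"
  unfolding pw_continuous_def
  by (metis Diff_empty compact_Icc compact_continuous_image compact_imp_bounded finite.emptyI)

text \<open>Treats inner products, scalar multiples and matrix-vector products at once: the
  exceptional sets are united, and the two bounds are multiplied with the constant of
  \<open>h\<close>.\<close>

lemma pw_continuous_bilinear:
  assumes h: "bounded_bilinear h" and f: "pw_continuous a b f" and g: "pw_continuous a b g"
  shows "pw_continuous a b (\<lambda>t. h (f t) (g t))"
proof -
  interpret bounded_bilinear h by (rule h)
  obtain K where K: "0 < K" "\<And>x y. norm (h x y) \<le> norm x * norm y * K"
    using pos_bounded by blast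
  obtain M F where M: "0 < M" "\<forall>t\<in>{a..b}. norm (f t) \<le> M"
    "finite F" "continuous_on ({a..b} - F) f" by (rule pw_continuousE[OF f])
  obtain N G where N: "0 < N" "\<forall>t\<in>{a..b}. norm (g t) \<le> N"
    "finite G" "continuous_on ({a..b} - G) g" by (rule pw_continuousE[OF g])
  show ?thesis
  proof (rule pw_continuousI)
    show "norm (h (f t) (g t)) \<le> M * N * K" if "t \<in> {a..b}" for t
    proof -
      have "norm (f t) * norm (g t) \<le> M * N"
        using M N that by (intro mult_mono) auto
      then have "norm (f t) * norm (g t) * K \<le> M * N * K" using K(1) by simp
      then show ?thesis using K(2)[of "f t" "g t"] by linarith
    qed
    show "finite (F \<union> G)" using M N by simp
    show "continuous_on ({a..b} - (F \<union> G)) (\<lambda>t. h (f t) (g t))"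
      by (rule continuous_on) (use M(4) N(4) in \<open>auto elim: continuous_on_subset\<close>)
  qed
qed

lemma pw_continuous_add:
  assumes f: "pw_continuous a b f" and g: "pw_continuous a b g"
  shows "pw_continuous a b (\<lambda>t. f t + g t)"
proof -
  obtain M F where M: "0 < M" "\<forall>t\<in>{a..b}. norm (f t) \<le> M"
    "finite F" "continuous_on ({a..b} - F) f" by (rule pw_continuousE[OF f])
  obtain N G where N: "0 < N" "\<forall>t\<in>{a..b}. norm (g t) \<le> N"
    "finite G" "continuous_on ({a..b} - G) g" by (rule pw_continuousE[OF g])
  show ?thesis
  proof (rule pw_continuousI)
    show "norm (f t + g t) \<le> M + N" if "t \<in> {a..b}" for t
      using M N that by (intro norm_triangle_mono) auto
    show "finite (F \<union> G)" using M N by simp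
    show "continuous_on ({a..b} - (F \<union> G)) (\<lambda>t. f t + g t)"
      by (rule continuous_on_add) (use M(4) N(4) in \<open>auto elim: continuous_on_subset\<close>)
  qed
qed

lemma pw_continuous_const: "pw_continuous a b (\<lambda>t. c)"
  by (intro continuous_imp_pw_continuous continuous_intros)

lemma pw_continuous_scaleR:
  "pw_continuous a b f \<Longrightarrow> pw_continuous a b (\<lambda>t. c *\<^sub>R f t)"
  by (rule pw_continuous_bilinear[OF bounded_bilinear_scaleR pw_continuous_const])

lemma pw_continuous_diff:
  "pw_continuous a b f \<Longrightarrow> pw_continuous a b g \<Longrightarrow> pw_continuous a b (\<lambda>t. f t - g t)"
  using pw_continuous_add[of a b f "\<lambda>t. (-1) *\<^sub>R g t"] pw_continuous_scaleR[of a b g "-1"] by simp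

lemmas pw_continuous_inner = pw_continuous_bilinear[OF bounded_bilinear_inner]

lemma bounded_bilinear_matrix_vector_mult:
  "bounded_bilinear ((*v) :: real ^ 'n ^ 'm \<Rightarrow> real ^ 'n \<Rightarrow> real ^ 'm)"
proof -
  have "bilinear ((*v) :: real ^ 'n ^ 'm \<Rightarrow> real ^ 'n \<Rightarrow> real ^ 'm)"
    unfolding bilinear_def
    by (auto intro!: linearI simp: matrix_vector_mult_add_rdistrib matrix_vector_right_distrib
        vec_eq_iff matrix_vector_mult_def sum_distrib_left sum.distrib algebra_simps)
  then show ?thesis using bilinear_conv_bounded_bilinear by blast
qed

lemmas pw_continuous_matrix_vector = pw_continuous_bilinear[OF bounded_bilinear_matrix_vector_mult]

text \<open>A matrix is a vector of rows, so its \<open>norm\<close> is the Frobenius norm;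
  Cauchy-Schwarz is applied to each row and the squares are summed.\<close>

lemma norm_matrix_vector_le:
  fixes A :: "real ^ 'n ^ 'm"
  shows "norm (A *v x) \<le> norm A * norm x"
proof (rule power2_le_imp_le)
  have "(norm (A *v x))\<^sup>2 = (\<Sum>i\<in>UNIV. (A $ i \<bullet> x)\<^sup>2)"
    by (simp add: power2_norm_eq_inner inner_vec_def[of "A *v x"] matrix_vector_mul_component)
       (simp add: power2_eq_square)
  also have "\<dots> \<le> (\<Sum>i\<in>UNIV. (norm (A $ i))\<^sup>2 * (norm x)\<^sup>2)"
    by (intro sum_mono) (metis Cauchy_Schwarz_ineq2 abs_ge_zero power2_abs power_mono power_mult_distrib)
  also have "\<dots> = (norm A * norm x)\<^sup>2"
    by (simp add: power_mult_distrib power2_norm_eq_inner inner_vec_def[of A] flip: sum_distrib_right)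
  finally show "(norm (A *v x))\<^sup>2 \<le> (norm A * norm x)\<^sup>2" .
qed simp

lemma pw_continuous_norm:
  assumes "pw_continuous a b f"
  shows "pw_continuous a b (\<lambda>t. norm (f t))"
proof -
  obtain M F where "0 < M" "\<forall>t\<in>{a..b}. norm (f t) \<le> M"
    "finite F" "continuous_on ({a..b} - F) f" by (rule pw_continuousE[OF assms])
  then show ?thesis
    by (intro pw_continuousI[of _ _ _ M F] continuous_on_norm) auto
qed

lemma pw_continuous_subinterval:
  assumes "pw_continuous a b f" "{c..d} \<subseteq> {a..b}"
  shows "pw_continuous c d f"
proof -
  obtain M F where "0 < M" "\<forall>t\<in>{a..b}. norm (f t) \<le> M"
    "finite F" "continuous_on ({a..b} - F) f" by (rule pw_continuousE[OF assms(1)])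
  with assms(2) show ?thesis
    by (intro pw_continuousI[of _ _ _ M F]) (blast intro: continuous_on_subset)+
qed

text \<open>Continuity gives measurability on \<open>{a..b} - F\<close>. The finite set
  \<open>F\<close> is null and Lebesgue measure is complete, so the values on \<open>F\<close> do
  not affect measurability.\<close>

lemma pw_continuous_measurable:
  fixes f :: "real \<Rightarrow> 'e::euclidean_space"
  assumes "pw_continuous a b f"
  shows "f \<in> borel_measurable (lebesgue_on {a..b})"
proof -
  obtain F where F: "finite F" "continuous_on ({a..b} - F) f"
    using assms unfolding pw_continuous_def by blast
  have "f \<in> borel_measurable (lebesgue_on ({a..b} - F))"
    by (rule continuous_imp_measurable_on_sets_lebesgue[OF F(2)])
       (rule sets.Diff[OF _ negligible_imp_sets[OF negligible_finite[OF F(1)]]], simp)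
  moreover have "F \<inter> {a..b} \<in> null_sets (lebesgue_on {a..b})"
  proof -
    have "negligible (F \<inter> {a..b})" using F(1) by (intro negligible_finite) simp
    then show ?thesis
      by (subst null_sets_restrict_space) (use negligible_iff_null_sets in auto)
  qed
  moreover have "{a..b} - F \<inter> {a..b} = {a..b} - F" by auto
  ultimately show ?thesis
    using borel_measurable_diff_null[of "F \<inter> {a..b}" "{a..b}" f] by simp
qed


lemma pw_continuous_integrable_lebesgue:
  fixes f :: "real \<Rightarrow> 'e::euclidean_space"
  assumes "pw_continuous a b f"
  shows "integrable (lebesgue_on {a..b}) f"
proof -
  obtain M where M: "\<forall>t\<in>{a..b}. norm (f t) \<le> M"
    by (rule pw_continuousE[OF assms]) blast
  show ?thesis
    by (rule measurable_bounded_by_integrable_imp_lebesgue_integrable[of _ _ "\<lambda>_. M"])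
       (use pw_continuous_measurable[OF assms] M in auto)
qed

lemma pw_continuous_integrable:
  fixes f :: "real \<Rightarrow> 'e::euclidean_space"
  assumes "pw_continuous a b f"
  shows "f integrable_on {a..b}"
  by (rule integrable_on_lebesgue_on[OF pw_continuous_integrable_lebesgue[OF assms]]) simp

lemma pw_continuous_lebesgue_integral:
  fixes f :: "real \<Rightarrow> 'e::euclidean_space"
  assumes "pw_continuous a b f"
  shows "integral\<^sup>L (lebesgue_on {a..b}) f = integral {a..b} f"
  by (rule lebesgue_integral_eq_integral[OF pw_continuous_integrable_lebesgue[OF assms]]) simp

lemma pw_continuous_in_L2:
  fixes f :: "real \<Rightarrow> 'e::euclidean_space"
  assumes "pw_continuous a b f"
  shows "f \<in> L2_on a b"
  unfolding L2_on_def power2_norm_eq_inner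
  using pw_continuous_measurable[OF assms]
    pw_continuous_integrable_lebesgue[OF pw_continuous_inner[OF assms assms]] by simp

subsection \<open>Absolutely continuous functions\<close>

text \<open>
  The Henstock--Kurzweil gauge handles the exceptional null set directly: intervals tagged in it lie
  in an open set of small measure, where absolute continuity bounds the increments.
\<close>

lemma abs_continuous_on_has_integral:
  fixes q :: "real \<Rightarrow> 'e::euclidean_space"
  assumes ab: "a \<le> b" and ac: "abs_continuous_on {a..b} q"
    and der: "AE t in lebesgue_on {a..b}. (q has_vector_derivative g t) (at t within {a..b})"
  shows "(g has_integral (q b - q a)) {a..b}"
proof -
  define N where "N = {t \<in> {a..b}. \<not> (q has_vector_derivative g t) (at t within {a..b})}"
  have neg: "negligible N"
    using der by (simp add: N_def AE_restrict_space_iff eventually_ae_filter_negligible)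
      (auto elim: negligible_subset)
  \<comment> \<open>With the integrand set to zero on the null set, an interval tagged in
    \<open>N\<close> contributes only its increment of \<open>q\<close>, which absolute continuity
    controls.\<close>
  define g' where "g' = (\<lambda>t. if t \<in> N then 0 else g t)"
  have "(g' has_integral (q b - q a)) {a..b}"
    unfolding has_integral_real
  proof (intro allI impI)
    fix e :: real assume e: "e > 0"
    \<comment> \<open>The summand 1 keeps the denominator positive when \<open>a = b\<close> and
      makes \<open>e1 * (b - a) < e / 2\<close> strict.\<close>
    define e1 where "e1 = e / (2 * (b - a + 1))"
    have e1: "e1 > 0" using e ab by (simp add: e1_def)
    have e1b: "e1 * (b - a) < e / 2"
      using e ab by (simp add: e1_def field_simps)
    obtain \<delta> where \<delta>: "\<delta> > 0"
      "\<And>d. d division_of \<Union>d \<Longrightarrow> \<Union>d \<subseteq> {a..b} \<Longrightarrow> (\<Sum>k\<in>d. Sup k - Inf k) < \<delta> \<Longrightarrow>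
        (\<Sum>k\<in>d. norm (q (Sup k) - q (Inf k))) < e / 2"
      using ac e unfolding abs_continuous_on_def by (meson half_gt_zero)
    obtain U where U: "open U" "N \<subseteq> U" "U \<in> lmeasurable" "measure lebesgue U < \<delta>"
    proof -
      have Nl: "N \<in> lmeasurable" "measure lebesgue N = 0"
        using neg negligible_imp_measurable negligible_imp_measure0 by blast+
      obtain T where T: "open T" "N \<subseteq> T" "T - N \<in> lmeasurable"
        "emeasure lebesgue (T - N) < ennreal \<delta>"
        using sets_lebesgue_outer_open[OF fmeasurableD[OF Nl(1)] \<delta>(1)] .
      have TN: "T = (T - N) \<union> N" using T(2) by blast
      have "T \<in> lmeasurable" by (subst TN) (intro fmeasurable.Un T Nl)
      moreover have "measure lebesgue T \<le> measure lebesgue (T - N) + measure lebesgue N"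
        by (subst TN) (intro measure_Un_le fmeasurableD T Nl)
      moreover have "measure lebesgue (T - N) < \<delta>"
        using T(3,4) \<delta>(1) by (simp add: emeasure_eq_measure2 ennreal_less_iff)
      ultimately show ?thesis using that[of T] T Nl by simp
    qed
    have "\<exists>d>0. \<forall>y\<in>{a..b}. \<bar>y - t\<bar> < d \<longrightarrow> norm (q y - q t - (y - t) *\<^sub>R g t) \<le> e1 * \<bar>y - t\<bar>"
      if "t \<in> {a..b} - N" for t
      using that e1 unfolding N_def has_vector_derivative_def has_derivative_within_alt by auto
    then obtain d where d: "\<And>t. t \<in> {a..b} - N \<Longrightarrow> d t > 0"
      "\<And>t y. t \<in> {a..b} - N \<Longrightarrow> y \<in> {a..b} \<Longrightarrow> \<bar>y - t\<bar> < d t \<Longrightarrow>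
         norm (q y - q t - (y - t) *\<^sub>R g t) \<le> e1 * \<bar>y - t\<bar>"
      by metis
    define \<gamma> where "\<gamma> = (\<lambda>t. if t \<in> N then U else if t \<in> {a..b} then ball t (d t) else UNIV)"
    have "gauge \<gamma>"
      unfolding gauge_def \<gamma>_def using U d(1) by auto
    moreover have "norm ((\<Sum>(x,k)\<in>p. measure lborel k *\<^sub>R g' x) - (q b - q a)) < e"
      if p: "p tagged_division_of {a..b}" and fine: "\<gamma> fine p" for p
    proof -
      define err where "err = (\<lambda>(x,k). measure lborel k *\<^sub>R g' x - (q (Sup k) - q (Inf k)))"
      define P where "P = {(x,k) \<in> p. x \<in> N}"
      have fp: "finite p" using p by blast
      have Pp: "P \<subseteq> p" by (auto simp: P_def)
      have fP: "finite P" using fp Pp finite_subset by blast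
      have interval: "\<exists>u v. k = {u..v} \<and> u \<le> x \<and> x \<le> v \<and> a \<le> u \<and> v \<le> b" if xk: "(x,k) \<in> p" for x k
      proof -
        obtain u v where "k = cbox u v" using tagged_division_ofD(4)[OF p xk] by blast
        moreover have "x \<in> k" "k \<subseteq> {a..b}" using tagged_division_ofD(2,3)[OF p xk] by auto
        ultimately show ?thesis by (intro exI[of _ u] exI[of _ v]) (auto simp: cbox_interval)
      qed
      have nonempty: "k \<noteq> {}" if "(x,k) \<in> P" for x k
        using tagged_division_ofD(2)[OF p] that Pp by blast
      have "(\<Sum>(x,k)\<in>p. q (Sup k) - q (Inf k)) = q b - q a"
        by (rule additive_tagged_division_1[OF ab p])
      then have eq: "(\<Sum>(x,k)\<in>p. measure lborel k *\<^sub>R g' x) - (q b - q a) = sum err p"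
        by (simp add: err_def sum_subtractf case_prod_beta)
      have split: "sum err p = sum err P + sum err (p - P)"
        using sum.subset_diff[OF Pp fp, of err] by simp
      have "norm (sum err (p - P)) \<le> (\<Sum>(x,k)\<in>p - P. e1 * measure lborel k)"
      proof (rule sum_norm_le, clarify)
        fix x k assume xk: "(x,k) \<in> p" "(x,k) \<notin> P"
        then have xN: "x \<notin> N" by (auto simp: P_def)
        obtain u v where uv: "k = {u..v}" "u \<le> x" "x \<le> v" "a \<le> u" "v \<le> b"
          using interval[OF xk(1)] by blast
        have x: "x \<in> {a..b} - N" using uv xN by auto
        have "k \<subseteq> \<gamma> x" using fine xk(1) by (auto simp: fine_def)
        then have "k \<subseteq> ball x (d x)" using x by (simp add: \<gamma>_def)
        moreover have "u \<in> k" "v \<in> k" using uv by auto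
        ultimately have "u \<in> ball x (d x)" "v \<in> ball x (d x)" by blast+
        then have "\<bar>u - x\<bar> < d x" "\<bar>v - x\<bar> < d x" by (auto simp: dist_real_def)
        from d(2)[OF x _ this(1)] d(2)[OF x _ this(2)] have "norm (q u - q x - (u - x) *\<^sub>R g x) \<le> e1 * \<bar>u - x\<bar>"
          "norm (q v - q x - (v - x) *\<^sub>R g x) \<le> e1 * \<bar>v - x\<bar>"
          using uv by auto
        \<comment> \<open>Straddle estimate: the tag \<open>x\<close> lies between \<open>u\<close>
          and \<open>v\<close>, so the linearization errors at the two end points add up to exactly
          \<open>e1 * (v - u)\<close>.\<close>
        then have "norm ((q u - q x - (u - x) *\<^sub>R g x) - (q v - q x - (v - x) *\<^sub>R g x))
          \<le> e1 * \<bar>u - x\<bar> + e1 * \<bar>v - x\<bar>"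
          by (meson add_mono norm_triangle_ineq4 order_trans)
        also have "\<dots> = e1 * (v - u)" using uv by (simp add: algebra_simps)
        also have "(q u - q x - (u - x) *\<^sub>R g x) - (q v - q x - (v - x) *\<^sub>R g x) = err (x,k)"
          using uv xN by (simp add: err_def g'_def algebra_simps)
        finally show "norm (err (x,k)) \<le> e1 * measure lborel k" using uv by simp
      qed
      also have "\<dots> \<le> (\<Sum>(x,k)\<in>p. e1 * measure lborel k)"
        by (rule sum_mono2[OF fp]) (use e1 in auto)
      also have "\<dots> = e1 * (b - a)"
        using additive_content_tagged_division[of p a b] p ab
        by (simp add: case_prod_beta sum_distrib_left[symmetric] cbox_interval)
      finally have 1: "norm (sum err (p - P)) \<le> e1 * (b - a)" .
      have Pt: "P tagged_division_of \<Union>(snd ` P)"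
        using tagged_partial_division_subset[OF _ Pp] tagged_partial_division_of_Union_self
          p tagged_division_of_def by blast
      then have Pd: "snd ` P division_of \<Union>(snd ` P)" by (rule division_of_tagged_division)
      have "\<Union>(snd ` P) \<subseteq> {a..b}"
      proof (rule Union_least)
        fix k assume "k \<in> snd ` P"
        then obtain x where "(x,k) \<in> p" by (auto simp: P_def)
        then show "k \<subseteq> {a..b}" by (rule tagged_division_ofD(3)[OF p])
      qed
      moreover have "(\<Sum>k\<in>snd ` P. Sup k - Inf k) < \<delta>"
      proof -
        have "Sup k - Inf k = measure lebesgue k" if kP: "k \<in> snd ` P" for k
        proof -
          obtain x where "(x, k) \<in> p" using kP by (auto simp: P_def)
          then obtain u v where "k = {u..v}" "u \<le> v" using interval[of x k] by auto
          then show ?thesis by simp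
        qed
        then have "(\<Sum>k\<in>snd ` P. Sup k - Inf k) = (\<Sum>k\<in>snd ` P. measure lebesgue k)"
          by (rule sum.cong[OF refl])
        also have "\<dots> = measure lebesgue (\<Union>(snd ` P))"
          using content_division[OF Pd] by simp
        also have "\<dots> \<le> measure lebesgue U"
        proof (rule measure_mono_fmeasurable)
          show "\<Union>(snd ` P) \<subseteq> U"
          proof (rule Union_least)
            fix k assume "k \<in> snd ` P"
            then obtain x where xk: "(x,k) \<in> p" "x \<in> N" by (auto simp: P_def)
            then have "k \<subseteq> \<gamma> x" using fine by (auto simp: fine_def)
            then show "k \<subseteq> U" using xk(2) by (simp add: \<gamma>_def)
          qed
          show "\<Union>(snd ` P) \<in> sets lebesgue"
            using Pd lmeasurable_division by blast
        qed (rule U)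
        finally show ?thesis using U(4) by simp
      qed
      ultimately have 2: "(\<Sum>k\<in>snd ` P. norm (q (Sup k) - q (Inf k))) < e / 2"
        by (intro \<delta>(2) Pd)
      \<comment> \<open>Different tags can share one degenerate interval, so replacing the sum over
        \<open>P\<close> by a sum over intervals needs a summand that vanishes on degenerate
        intervals. The empty set is singled out because \<open>Sup {}\<close> and
        \<open>Inf {}\<close> have no useful value.\<close>
      define \<phi> where "\<phi> = (\<lambda>k. if k = {} then 0 else norm (q (Sup k) - q (Inf k)))"
      have "norm (sum err P) \<le> (\<Sum>(x,k)\<in>P. \<phi> k)"
      proof (rule sum_norm_le)
        fix z assume z: "z \<in> P"
        obtain x k where [simp]: "z = (x,k)" by (cases z)
        have "k \<noteq> {}" using nonempty z by simp
        moreover have "g' x = 0" using z by (simp add: P_def g'_def)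
        ultimately show "norm (err z) \<le> (case z of (x,k) \<Rightarrow> \<phi> k)"
          by (simp add: err_def \<phi>_def norm_minus_commute)
      qed
      also have "\<dots> = (\<Sum>k\<in>snd ` P. \<phi> k)"
      proof (rule sum.over_tagged_division_lemma[OF Pt])
        fix u v :: real assume "box u v = {}"
        then have "cbox u v = {} \<or> u = v" by auto
        then show "\<phi> (cbox u v) = 0"
          by (auto simp: \<phi>_def)
      qed
      also have "\<dots> \<le> (\<Sum>k\<in>snd ` P. norm (q (Sup k) - q (Inf k)))"
        by (rule sum_mono) (simp add: \<phi>_def)
      finally have "norm (sum err P) < e / 2" using 2 by simp
      with 1 e1b have "norm (sum err p) < e"
        unfolding split using norm_triangle_ineq[of "sum err P" "sum err (p - P)"] by linarith
      then show ?thesis by (simp only: eq)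
    qed
    ultimately show "\<exists>\<gamma>. gauge \<gamma> \<and> (\<forall>p. p tagged_division_of {a..b} \<and> \<gamma> fine p \<longrightarrow>
        norm ((\<Sum>(x,k)\<in>p. measure lborel k *\<^sub>R g' x) - (q b - q a)) < e)"
      by (intro exI[of _ \<gamma>] conjI allI impI) simp_all
  qed
  then show ?thesis
    using has_integral_spike[OF neg, of "{a..b}" g g' "q b - q a"] by (simp add: g'_def)
qed

subsection \<open>Linear Volterra equations\<close>

text \<open>The majorant \<open>G\<close> has derivative \<open>M * f\<close>, which is at most
  \<open>M * G\<close>. Hence \<open>H\<close>, the product of \<open>G\<close> with the integrating
  factor, is nonincreasing and stays below \<open>H a = c\<close>.\<close>

lemma gronwall:
  fixes f :: "real \<Rightarrow> real"
  assumes f: "continuous_on {a..b} f" and M: "0 \<le> M"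
    and le: "\<And>t. t \<in> {a..b} \<Longrightarrow> f t \<le> c + M * integral {a..t} f"
    and t: "t \<in> {a..b}"
  shows "f t \<le> c * exp (M * (t - a))"
proof -
  define G where "G = (\<lambda>t. c + M * integral {a..t} f)"
  define H where "H = (\<lambda>t. G t * exp (- M * (t - a)))"
  have der: "((\<lambda>t. integral {a..t} f) has_real_derivative f s) (at s)" if "a < s" "s < b" for s
    using integral_has_real_derivative[OF f, of s] that at_within_Icc_at[of a s b] by simp
  have "H t \<le> H a"
  proof (rule DERIV_nonpos_imp_decreasing_open[where f = H])
    show "a \<le> t" using t by simp
    fix s assume s: "a < s" "s < t"
    have "(H has_real_derivative (M * f s * exp (- M * (s - a)) + (- M * exp (- M * (s - a))) * G s)) (at s)"
      unfolding H_def G_def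
      by (rule derivative_eq_intros der | use s t in simp)+
    moreover have "M * f s * exp (- M * (s - a)) + (- M * exp (- M * (s - a))) * G s
        = (M * exp (- M * (s - a))) * (f s - G s)" by (simp add: algebra_simps)
    moreover have "\<dots> \<le> 0"
      using le[of s] s t M by (intro mult_nonneg_nonpos) (auto simp: G_def)
    ultimately show "\<exists>y. (H has_real_derivative y) (at s) \<and> y \<le> 0" by metis
  next
    have "continuous_on {a..b} (\<lambda>t. integral {a..t} f)"
      by (rule indefinite_integral_continuous_1[OF integrable_continuous_real[OF f]])
    then show "continuous_on {a..t} H"
      unfolding H_def G_def using t
      by (intro continuous_intros) (auto elim: continuous_on_subset)
  qed
  then have "G t * exp (- M * (t - a)) \<le> c" by (simp add: H_def G_def)
  then have "G t * exp (- M * (t - a)) * exp (M * (t - a)) \<le> c * exp (M * (t - a))"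
    by (rule mult_right_mono) simp
  then have "G t \<le> c * exp (M * (t - a))" by (simp add: mult.assoc flip: exp_add)
  with le[OF t] show ?thesis by (simp add: G_def)
qed

text \<open>Terms of the Neumann series of the equation
  \<open>q t = F t + integral {a..t} (\<lambda>s. A s *v q s)\<close>: the integral operator is
  applied \<open>k\<close> times to \<open>F\<close>.\<close>

primrec volterra_term ::
  "(real \<Rightarrow> real ^ 'n ^ 'n) \<Rightarrow> real \<Rightarrow> (real \<Rightarrow> real ^ 'n) \<Rightarrow> nat \<Rightarrow> real \<Rightarrow> real ^ 'n" where
  "volterra_term A a F 0 = F"
| "volterra_term A a F (Suc k) = (\<lambda>t. integral {a..t} (\<lambda>s. A s *v volterra_term A a F k s))"

lemmas continuous_on_matrix_vector =
  bounded_bilinear.continuous_on[OF bounded_bilinear_matrix_vector_mult]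

lemma continuous_volterra_term:
  assumes "continuous_on {a..b} A" "continuous_on {a..b} F"
  shows "continuous_on {a..b} (volterra_term A a F k)"
proof (induction k)
  case (Suc k)
  then show ?case
    using assms by (simp add: indefinite_integral_continuous_1 integrable_continuous_real
        continuous_on_matrix_vector)
qed (use assms in simp)

text \<open>Every application of the integral operator contributes a factor \<open>M\<close> and one
  integration of a power of \<open>s - a\<close>; the successive integrations produce the
  factorial.\<close>

lemma volterra_term_bound:
  assumes A: "continuous_on {a..b} A" and F: "continuous_on {a..b} F"
    and M: "0 \<le> M" "\<And>t. t \<in> {a..b} \<Longrightarrow> norm (A t) \<le> M"
    and C: "0 \<le> C" "\<And>t. t \<in> {a..b} \<Longrightarrow> norm (F t) \<le> C"
    and t: "t \<in> {a..b}"
  shows "norm (volterra_term A a F k t) \<le> C * (M * (t - a)) ^ k / fact k"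
  using t
proof (induction k arbitrary: t)
  case (Suc k)
  have sub: "{a..t} \<subseteq> {a..b}" using Suc.prems by auto
  \<comment> \<open>The bound claimed for \<open>Suc k\<close> is itself the antiderivative of the
    bound on the integrand, and it vanishes at \<open>a\<close>.\<close>
  let ?p = "\<lambda>s. C * (M * (s - a)) ^ Suc k / fact (Suc k)"
  have "((\<lambda>s. M * (C * (M * (s - a)) ^ k / fact k)) has_integral (?p t - ?p a)) {a..t}"
  proof (rule fundamental_theorem_of_calculus)
    show "a \<le> t" using Suc.prems by simp
    show "(?p has_vector_derivative M * (C * (M * (s - a)) ^ k / fact k)) (at s within {a..t})" for s
      unfolding has_real_derivative_iff_has_vector_derivative[symmetric]
      by (rule derivative_eq_intros refl | simp add: divide_simps)+
  qed
  moreover have "norm (A s *v volterra_term A a F k s) \<le> M * (C * (M * (s - a)) ^ k / fact k)"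
    if "s \<in> {a..t}" for s
  proof -
    have "norm (A s) * norm (volterra_term A a F k s) \<le> M * (C * (M * (s - a)) ^ k / fact k)"
      using that sub M by (intro mult_mono Suc.IH) auto
    then show ?thesis using norm_matrix_vector_le order_trans by blast
  qed
  moreover have "(\<lambda>s. A s *v volterra_term A a F k s) integrable_on {a..t}"
    using continuous_on_subset[OF A sub] continuous_on_subset[OF continuous_volterra_term[OF A F] sub]
    by (intro integrable_continuous_real continuous_on_matrix_vector)
  ultimately have "norm (integral {a..t} (\<lambda>s. A s *v volterra_term A a F k s)) \<le> ?p t - ?p a"
    using integral_norm_bound_integral
    by (metis (no_types, lifting) has_integral_integrable_integral)
  then show ?case by simp
qed (use C in simp)

text \<open>The Neumann series is dominated by an exponential series and so converges uniformly on
  all of \<open>{a..b}\<close>; the limit can then be taken under the integral. Unlike a contraction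
  argument, this does not require cutting the interval into short pieces.\<close>

lemma volterra_equation_solvable:
  fixes A :: "real \<Rightarrow> real ^ 'n ^ 'n"
  assumes A: "continuous_on {a..b} A" and F: "continuous_on {a..b} F"
  obtains q where "continuous_on {a..b} q"
    "\<And>t. t \<in> {a..b} \<Longrightarrow> q t = F t + integral {a..t} (\<lambda>s. A s *v q s)"
proof -
  define y where "y = volterra_term A a F"
  define q where "q = (\<lambda>t. \<Sum>k. y k t)"
  obtain M where M: "0 < M" "\<forall>t\<in>{a..b}. norm (A t) \<le> M"
    by (rule pw_continuousE[OF continuous_imp_pw_continuous[OF A]])
  obtain C where C: "0 < C" "\<forall>t\<in>{a..b}. norm (F t) \<le> C"
    by (rule pw_continuousE[OF continuous_imp_pw_continuous[OF F]])
  have y_cont: "continuous_on {a..b} (y k)" for k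
    unfolding y_def by (rule continuous_volterra_term[OF A F])
  have y_bound: "norm (y k t) \<le> C * ((M * (b - a)) ^ k / fact k)" if t: "t \<in> {a..b}" for k t
  proof -
    have "norm (y k t) \<le> C * (M * (t - a)) ^ k / fact k"
      unfolding y_def using M C by (intro volterra_term_bound[OF A F _ _ _ _ t]) auto
    also have "\<dots> \<le> C * (M * (b - a)) ^ k / fact k"
      using M C t by (intro divide_right_mono mult_left_mono power_mono) auto
    finally show ?thesis by simp
  qed
  have summ: "summable (\<lambda>k. C * ((M * (b - a)) ^ k / fact k))"
    using summable_exp_generic[of "M * (b - a)"] by (intro summable_mult) (simp add: divide_inverse_commute)
  have lim: "uniform_limit {a..b} (\<lambda>n t. \<Sum>k<n. y k t) q sequentially"
    unfolding q_def by (rule Weierstrass_m_test[OF y_bound summ])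
  have q_cont: "continuous_on {a..b} q"
    by (rule uniform_limit_theorem[OF _ lim]) (auto intro!: always_eventually continuous_on_sum y_cont)
  have "q t = F t + integral {a..t} (\<lambda>s. A s *v q s)" if t: "t \<in> {a..b}" for t
  proof -
    have sub: "{a..t} \<subseteq> {a..b}" using t by auto
    have bdd: "bounded (A ` {a..t})" "bounded (q ` {a..t})"
      using A q_cont sub by (metis compact_Icc compact_continuous_image compact_imp_bounded continuous_on_subset)+
    have "uniform_limit {a..t} (\<lambda>n s. A s *v (\<Sum>k<n. y k s)) (\<lambda>s. A s *v q s) sequentially"
      by (rule bounded_bilinear.bounded_uniform_limit[OF bounded_bilinear_matrix_vector_mult
            uniform_limit_const uniform_limit_on_subset[OF lim sub] bdd(2,1)])
    moreover have "continuous_on {a..t} (\<lambda>s. A s *v (\<Sum>k<n. y k s))" for n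
      using continuous_on_subset[OF A sub] continuous_on_subset[OF y_cont sub]
      by (intro continuous_on_matrix_vector continuous_on_sum)
    ultimately obtain I J where I: "\<And>n. ((\<lambda>s. A s *v (\<Sum>k<n. y k s)) has_integral I n) {a..t}"
      and J: "((\<lambda>s. A s *v q s) has_integral J) {a..t}" and IJ: "I \<longlonglongrightarrow> J"
      by (rule uniform_limit_integral) auto
    then have "(\<lambda>n. integral {a..t} (\<lambda>s. A s *v (\<Sum>k<n. y k s)))
        \<longlonglongrightarrow> integral {a..t} (\<lambda>s. A s *v q s)"
      using integral_unique[OF I] integral_unique[OF J] by simp
    then have "(\<lambda>n. F t + integral {a..t} (\<lambda>s. A s *v (\<Sum>k<n. y k s)))
        \<longlonglongrightarrow> F t + integral {a..t} (\<lambda>s. A s *v q s)"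
      by (intro tendsto_intros)
    \<comment> \<open>Inserting a partial sum into the right-hand side yields the next partial sum:
      the integral shifts every index by one, and \<open>F\<close> supplies the term of index
      0.\<close>
    moreover have "F t + integral {a..t} (\<lambda>s. A s *v (\<Sum>k<n. y k s)) = (\<Sum>k<Suc n. y k t)" for n
    proof -
      have int: "(\<lambda>s. A s *v y k s) integrable_on {a..t}" for k
        using continuous_on_subset[OF A sub] continuous_on_subset[OF y_cont sub]
        by (intro integrable_continuous_real continuous_on_matrix_vector)
      have "integral {a..t} (\<lambda>s. A s *v (\<Sum>k<n. y k s)) = (\<Sum>k<n. integral {a..t} (\<lambda>s. A s *v y k s))"
        by (subst integral_sum[symmetric]) (auto simp: int bounded_bilinear.sum_right[OF bounded_bilinear_matrix_vector_mult])
      then show ?thesis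
        by (simp only: sum.lessThan_Suc_shift) (simp add: y_def)
    qed
    ultimately have "(\<lambda>n. \<Sum>k<Suc n. y k t) \<longlonglongrightarrow> F t + integral {a..t} (\<lambda>s. A s *v q s)"
      by simp
    moreover have "(\<lambda>n. \<Sum>k<Suc n. y k t) \<longlonglongrightarrow> q t"
      using tendsto_uniform_limitI[OF lim t] by (rule LIMSEQ_Suc)
    ultimately show ?thesis by (rule LIMSEQ_unique[rotated])
  qed
  with q_cont that show ?thesis by blast
qed

subsection \<open>States\<close>

lemma abs_continuous_on_subset:
  "abs_continuous_on X f \<Longrightarrow> Y \<subseteq> X \<Longrightarrow> abs_continuous_on Y f"
  unfolding abs_continuous_on_def by (meson order_trans)

text \<open>The family consisting of the single interval between \<open>s\<close> and
  \<open>t\<close> is tested; \<open>min\<close> and \<open>max\<close> put its end points in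
  order.\<close>

lemma abs_continuous_on_imp_continuous_on:
  fixes f :: "real \<Rightarrow> 'e::real_normed_vector"
  assumes "abs_continuous_on {a..b} f"
  shows "continuous_on {a..b} f"
proof (rule continuous_onI)
  fix t and \<epsilon> :: real assume t: "t \<in> {a..b}" and "\<epsilon> > 0"
  then obtain \<delta> where \<delta>: "\<delta> > 0"
    "\<And>d. d division_of \<Union>d \<Longrightarrow> \<Union>d \<subseteq> {a..b} \<Longrightarrow> (\<Sum>k\<in>d. Sup k - Inf k) < \<delta> \<Longrightarrow>
      (\<Sum>k\<in>d. norm (f (Sup k) - f (Inf k))) < \<epsilon>"
    using assms unfolding abs_continuous_on_def by meson
  have "dist (f s) (f t) \<le> \<epsilon>" if s: "s \<in> {a..b}" "dist s t < \<delta>" for s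
  proof -
    have "{{min s t..max s t}} division_of \<Union>{{min s t..max s t}}"
      using division_of_self[of "min s t" "max s t"] by (simp add: cbox_interval)
    then have "norm (f (max s t) - f (min s t)) < \<epsilon>"
      using \<delta>(2)[of "{{min s t..max s t}}"] s t by (auto simp: dist_real_def)
    then show ?thesis
      by (cases "s \<le> t") (auto simp: dist_norm norm_minus_commute)
  qed
  with \<delta>(1) show "\<exists>d>0. \<forall>s\<in>{a..b}. dist s t < d \<longrightarrow> dist (f s) (f t) \<le> \<epsilon>" by blast
qed

lemma Lipschitz_imp_abs_continuous_on:
  fixes f :: "real \<Rightarrow> 'e::real_normed_vector"
  assumes K: "0 \<le> K"
    and lip: "\<And>s t. a \<le> s \<Longrightarrow> s \<le> t \<Longrightarrow> t \<le> b \<Longrightarrow> norm (f t - f s) \<le> K * (t - s)"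
  shows "abs_continuous_on {a..b} f"
  unfolding abs_continuous_on_def
proof (intro allI impI exI conjI)
  fix \<epsilon> :: real assume \<epsilon>: "\<epsilon> > 0"
  \<comment> \<open>Dividing by \<open>K + 1\<close> instead of \<open>K\<close> covers the case of
    Lipschitz constant 0.\<close>
  show "\<epsilon> / (K + 1) > 0" using \<epsilon> K by simp
  fix d :: "real set set"
  assume d: "d division_of \<Union>d \<and> \<Union>d \<subseteq> {a..b} \<and> (\<Sum>k\<in>d. Sup k - Inf k) < \<epsilon> / (K + 1)"
  have len: "norm (f (Sup k) - f (Inf k)) \<le> K * (Sup k - Inf k) \<and> 0 \<le> Sup k - Inf k" if k: "k \<in> d" for k
  proof -
    obtain u v where "k = cbox u v" "k \<noteq> {}" using d k division_ofD(3,4) by metis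
    then have uv: "k = {u..v}" "u \<le> v" by auto
    have "{u..v} \<subseteq> {a..b}" using d k uv(1) by blast
    with uv show ?thesis using lip[of u v] by auto
  qed
  then have "(\<Sum>k\<in>d. norm (f (Sup k) - f (Inf k))) \<le> (\<Sum>k\<in>d. K * (Sup k - Inf k))"
    by (intro sum_mono) blast
  also have "\<dots> = K * (\<Sum>k\<in>d. Sup k - Inf k)" by (simp add: sum_distrib_left)
  also have "\<dots> \<le> (K + 1) * (\<Sum>k\<in>d. Sup k - Inf k)"
    using len by (intro mult_right_mono sum_nonneg) auto
  also have "\<dots> < \<epsilon>"
    using d K by (simp add: pos_less_divide_eq mult.commute)
  finally show "(\<Sum>k\<in>d. norm (f (Sup k) - f (Inf k))) < \<epsilon>" .
qed

text \<open>Boundedness of \<open>g\<close> makes the indefinite integral Lipschitz, hence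
  absolutely continuous, and the fundamental theorem applies at every point of continuity of
  \<open>g\<close>.\<close>

lemma pw_continuous_indefinite_integral:
  fixes g :: "real \<Rightarrow> 'e::euclidean_space"
  assumes g: "pw_continuous a b g" and q: "\<And>t. t \<in> {a..b} \<Longrightarrow> q t = c + integral {a..t} g"
  shows "abs_continuous_on {a..b} q"
    and "AE t in lebesgue_on {a..b}. (q has_vector_derivative g t) (at t within {a..b})"
proof -
  obtain M F where M: "0 < M" "\<forall>t\<in>{a..b}. norm (g t) \<le> M"
    and F: "finite F" "continuous_on ({a..b} - F) g" by (rule pw_continuousE[OF g])
  show "abs_continuous_on {a..b} q"
  proof (rule Lipschitz_imp_abs_continuous_on[of M])
    fix s t assume st: "a \<le> s" "s \<le> t" "t \<le> b"
    have int: "g integrable_on {a..t}" "g integrable_on {s..t}"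
      using st by (auto intro!: pw_continuous_integrable intro: pw_continuous_subinterval[OF g])
    have "integral {a..s} g + integral {s..t} g = integral {a..t} g"
      by (rule Henstock_Kurzweil_Integration.integral_combine[OF st(1,2) int(1)])
    moreover have "q t - q s = integral {a..t} g - integral {a..s} g"
      using q[of s] q[of t] st by simp
    ultimately have "q t - q s = integral {s..t} g" by (metis add_diff_cancel_left')
    also have "norm \<dots> \<le> integral {s..t} (\<lambda>_. M)"
      using M(2) st int(2) by (intro integral_norm_bound_integral) auto
    also have "\<dots> = M * (t - s)" using st by simp
    finally show "norm (q t - q s) \<le> M * (t - s)" .
  qed (use M in simp)
  \<comment> \<open>Discarding \<open>a\<close> and \<open>b\<close> along with \<open>F\<close>
    leaves points interior to \<open>{a..b} - F\<close>, where the derivative within that set is an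
    ordinary two-sided one.\<close>
  have "(q has_vector_derivative g t) (at t within {a..b})" if t: "t \<in> {a..b} - (F \<union> {a,b})" for t
  proof -
    have "continuous (at t within ({a..b} - F)) g"
      using F(2) t by (simp add: continuous_on_eq_continuous_within)
    then have "((\<lambda>s. integral {a..s} g) has_vector_derivative g t) (at t within ({a..b} - F))"
      using t by (intro integral_has_vector_derivative_continuous_at pw_continuous_integrable[OF g] F(1)) auto
    moreover have "at t within ({a..b} - F) = at t"
      using t F(1) by (intro at_within_open_subset[of _ "{a<..<b} - F"])
        (auto intro!: open_Diff finite_imp_closed)
    ultimately have "((\<lambda>s. c + integral {a..s} g) has_vector_derivative g t) (at t)"
      by (auto intro!: derivative_eq_intros)
    then have "((\<lambda>s. c + integral {a..s} g) has_vector_derivative g t) (at t within {a..b})"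
      by (rule has_vector_derivative_at_within)
    then show ?thesis
      using has_vector_derivative_transform[of t "{a..b}" q "\<lambda>s. c + integral {a..s} g" "g t"] t q
      by simp
  qed
  then show "AE t in lebesgue_on {a..b}. (q has_vector_derivative g t) (at t within {a..b})"
    using negligible_finite[of "F \<union> {a,b}"] F(1)
    by (auto simp: AE_restrict_space_iff eventually_ae_filter_negligible intro!: exI[of _ "F \<union> {a,b}"])
qed

section \<open>The controlled linear system as an integral equation\<close>

locale linear_control =
  fixes a b :: real and A :: "real \<Rightarrow> real ^ 'n ^ 'n" and B :: "real \<Rightarrow> real ^ 'm ^ 'n"
  assumes ab: "a < b"
    and A_cont: "continuous_on {a..b} A"
    and B_cont: "continuous_on {a..b} B"
begin

lemma pw_continuous_Bu:
  "continuous_on {a..b} \<omega> \<Longrightarrow> pw_continuous a b u \<Longrightarrow> pw_continuous a b (\<lambda>t. B t *v u t + \<omega> t)"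
  by (rule pw_continuous_add[OF pw_continuous_matrix_vector[OF continuous_imp_pw_continuous[OF B_cont]]
        continuous_imp_pw_continuous])

lemma pw_continuous_rhs:
  assumes "continuous_on {a..b} \<omega>" "pw_continuous a b u" "continuous_on {a..b} q"
  shows "pw_continuous a b (\<lambda>t. A t *v q t + B t *v u t + \<omega> t)"
  using pw_continuous_add[OF pw_continuous_matrix_vector[OF continuous_imp_pw_continuous[OF A_cont]
        continuous_imp_pw_continuous[OF assms(3)]] pw_continuous_Bu[OF assms(1,2)]]
  by (simp add: add.assoc)

text \<open>From left to right, the fundamental theorem for absolutely continuous functions is used
  on each \<open>{a..t}\<close>; from right to left, the integrand is piecewise continuous because
  \<open>q\<close> is continuous. From here on, states are handled only through the integral
  equation.\<close>

lemma is_state_iff_integral_equation: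
  assumes \<omega>: "continuous_on {a..b} \<omega>" and u: "pw_continuous a b u"
  shows "is_state a b A B \<omega> qa u q \<longleftrightarrow> continuous_on {a..b} q \<and>
    (\<forall>t\<in>{a..b}. q t = qa + integral {a..t} (\<lambda>s. A s *v q s + B s *v u s + \<omega> s))"
    (is "?L \<longleftrightarrow> ?R")
proof
  let ?g = "\<lambda>s. A s *v q s + B s *v u s + \<omega> s"
  assume ?L
  then have ac: "abs_continuous_on {a..b} q"
    and der: "AE t in lebesgue_on {a..b}. (q has_vector_derivative ?g t) (at t within {a..b})"
    and qa: "q a = qa" unfolding is_state_def by auto
  have "q t = qa + integral {a..t} ?g" if t: "t \<in> {a..b}" for t
  proof -
    have sub: "{a..t} \<subseteq> {a..b}" using t by auto
    have "AE t' in lebesgue_on {a..t}. (q has_vector_derivative ?g t') (at t' within {a..t})"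
    proof -
      have "AE t' in lebesgue. t' \<in> {a..b} \<longrightarrow> (q has_vector_derivative ?g t') (at t' within {a..b})"
        using der by (simp add: AE_restrict_space_iff)
      then have "AE t' in lebesgue. t' \<in> {a..t} \<longrightarrow> (q has_vector_derivative ?g t') (at t' within {a..t})"
        by (rule eventually_mono) (use sub has_vector_derivative_within_subset in blast)
      then show ?thesis by (simp add: AE_restrict_space_iff)
    qed
    then have "(?g has_integral (q t - q a)) {a..t}"
      using abs_continuous_on_has_integral[OF _ abs_continuous_on_subset[OF ac sub]] t by auto
    then show ?thesis using qa by (simp add: integral_unique)
  qed
  then show ?R using abs_continuous_on_imp_continuous_on[OF ac] by blast
next
  assume R: ?R
  then have "q a = qa" using ab by simp
  with R show ?L
    unfolding is_state_def
    using pw_continuous_indefinite_integral[of a b "\<lambda>s. A s *v q s + B s *v u s + \<omega> s" q qa]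
      pw_continuous_rhs[OF \<omega> u] by blast
qed

text \<open>Gronwall applied to \<open>norm (q t)\<close>, with the forcing replaced by its total
  integral over \<open>{a..b}\<close>. The constant depends only on \<open>A\<close> and the
  interval. The case \<open>g = 0\<close> gives uniqueness of states, and \<open>g = B w\<close>
  gives the bound on responses.\<close>

lemma integral_equation_estimate:
  obtains K where "0 < K"
    "\<And>g q t. \<lbrakk>pw_continuous a b g; continuous_on {a..b} q;
        \<And>t. t \<in> {a..b} \<Longrightarrow> q t = integral {a..t} (\<lambda>s. A s *v q s + g s); t \<in> {a..b}\<rbrakk>
      \<Longrightarrow> norm (q t) \<le> K * integral {a..b} (\<lambda>s. norm (g s))"
proof -
  obtain M where M: "0 < M" "\<forall>t\<in>{a..b}. norm (A t) \<le> M"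
    by (rule pw_continuousE[OF continuous_imp_pw_continuous[OF A_cont]])
  show ?thesis
  proof (rule that)
    show "0 < exp (M * (b - a))" by simp
    fix g :: "real \<Rightarrow> real ^ 'n" and q and t
    assume g: "pw_continuous a b g" and q: "continuous_on {a..b} q"
      and eq: "\<And>t. t \<in> {a..b} \<Longrightarrow> q t = integral {a..t} (\<lambda>s. A s *v q s + g s)"
      and t: "t \<in> {a..b}"
    let ?G = "integral {a..b} (\<lambda>s. norm (g s))"
    note ng = pw_continuous_norm[OF g]
    have G: "0 \<le> ?G" by (intro integral_nonneg pw_continuous_integrable ng) auto
    have "norm (q t) \<le> ?G * exp (M * (t - a))"
    proof (rule gronwall[of a b "\<lambda>t. norm (q t)", OF _ _ _ t])
      show "continuous_on {a..b} (\<lambda>t. norm (q t))" using q by (intro continuous_intros)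
      fix r assume r: "r \<in> {a..b}"
      then have sub: "{a..r} \<subseteq> {a..b}" by auto
      have pA: "pw_continuous a r (\<lambda>s. A s *v q s)"
        by (intro pw_continuous_matrix_vector continuous_imp_pw_continuous
            continuous_on_subset[OF A_cont sub] continuous_on_subset[OF q sub])
      have pq: "pw_continuous a r q"
        by (intro continuous_imp_pw_continuous continuous_on_subset[OF q sub])
      have pg: "pw_continuous a r g" by (rule pw_continuous_subinterval[OF g sub])
      have int: "(\<lambda>s. norm (q s)) integrable_on {a..r}" "(\<lambda>s. norm (g s)) integrable_on {a..r}"
        by (intro pw_continuous_integrable pw_continuous_norm pq pg)+
      have "norm (q r) \<le> integral {a..r} (\<lambda>s. M * norm (q s) + norm (g s))"
        unfolding eq[OF r]
      proof (rule integral_norm_bound_integral)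
        show "(\<lambda>s. A s *v q s + g s) integrable_on {a..r}"
          by (intro pw_continuous_integrable pw_continuous_add pA pg)
        show "(\<lambda>s. M * norm (q s) + norm (g s)) integrable_on {a..r}"
          using int by (intro integrable_add integrable_on_mult_right)
        fix s assume s: "s \<in> {a..r}"
        have "norm (A s *v q s) \<le> M * norm (q s)"
          using norm_matrix_vector_le[of "A s" "q s"] M(2) s sub
          by (meson mult_right_mono norm_ge_zero order_trans subsetD)
        then show "norm (A s *v q s + g s) \<le> M * norm (q s) + norm (g s)"
          using norm_triangle_ineq[of "A s *v q s" "g s"] by linarith
      qed
      also have "\<dots> = M * integral {a..r} (\<lambda>s. norm (q s)) + integral {a..r} (\<lambda>s. norm (g s))"
        using int by (subst integral_add) (auto intro: integrable_on_mult_right)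
      also have "integral {a..r} (\<lambda>s. norm (g s)) \<le> ?G"
        using sub int(2) pw_continuous_integrable[OF ng] by (intro integral_subset_le) auto
      finally show "norm (q r) \<le> ?G + M * integral {a..r} (\<lambda>s. norm (q s))" by simp
    qed (use M in simp)
    also have "\<dots> \<le> ?G * exp (M * (b - a))"
      using t M G by (intro mult_left_mono) auto
    finally show "norm (q t) \<le> exp (M * (b - a)) * ?G" by (simp add: mult.commute)
  qed
qed

text \<open>The difference of two states solves the homogeneous equation with initial value 0, so
  the estimate with zero forcing makes it vanish.\<close>

lemma is_state_unique:
  assumes \<omega>: "continuous_on {a..b} \<omega>" and u: "pw_continuous a b u"
    and "is_state a b A B \<omega> qa u p" "is_state a b A B \<omega> qa u q" and t: "t \<in> {a..b}"
  shows "p t = q t"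
proof -
  note iff = is_state_iff_integral_equation[OF \<omega> u]
  have p: "continuous_on {a..b} p"
      "\<And>t. t \<in> {a..b} \<Longrightarrow> p t = qa + integral {a..t} (\<lambda>s. A s *v p s + B s *v u s + \<omega> s)"
    using assms(3)[unfolded iff] by (rule conjunct1, rule bspec[OF conjunct2])
  have q: "continuous_on {a..b} q"
      "\<And>t. t \<in> {a..b} \<Longrightarrow> q t = qa + integral {a..t} (\<lambda>s. A s *v q s + B s *v u s + \<omega> s)"
    using assms(4)[unfolded iff] by (rule conjunct1, rule bspec[OF conjunct2])
  obtain K where K: "0 < K" "\<And>g q t. \<lbrakk>pw_continuous a b g; continuous_on {a..b} q;
        \<And>t. t \<in> {a..b} \<Longrightarrow> q t = integral {a..t} (\<lambda>s. A s *v q s + g s); t \<in> {a..b}\<rbrakk>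
      \<Longrightarrow> norm (q t) \<le> K * integral {a..b} (\<lambda>s. norm (g s :: real ^ 'n))"
    using integral_equation_estimate by blast
  have "norm (p t - q t) \<le> K * integral {a..b} (\<lambda>s. norm (0 :: real ^ 'n))"
  proof (rule K(2)[OF pw_continuous_const _ _ t])
    show "continuous_on {a..b} (\<lambda>t. p t - q t)" using p q by (intro continuous_intros)
    fix r assume r: "r \<in> {a..b}"
    then have sub: "{a..r} \<subseteq> {a..b}" by auto
    have "(\<lambda>s. A s *v x s + B s *v u s + \<omega> s) integrable_on {a..r}" if "continuous_on {a..b} x" for x
      by (rule pw_continuous_integrable[OF pw_continuous_subinterval[OF pw_continuous_rhs[OF \<omega> u that] sub]])
    then have "integral {a..r} (\<lambda>s. A s *v p s + B s *v u s + \<omega> s) - integral {a..r} (\<lambda>s. A s *v q s + B s *v u s + \<omega> s)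
        = integral {a..r} (\<lambda>s. (A s *v p s + B s *v u s + \<omega> s) - (A s *v q s + B s *v u s + \<omega> s))"
      using p(1) q(1) by (intro integral_diff[symmetric]) blast+
    also have "\<dots> = integral {a..r} (\<lambda>s. A s *v (p s - q s) + 0)"
      by (simp add: matrix_vector_mult_diff_distrib)
    finally show "p r - q r = integral {a..r} (\<lambda>s. A s *v (p s - q s) + 0)"
      by (subst p(2)[OF r], subst q(2)[OF r]) simp
  qed
  then show ?thesis by simp
qed

text \<open>\<open>state\<close> is a definite description, so it has to be shown that exactly one
  function qualifies. Existence comes from the Volterra equation whose inhomogeneity collects the
  terms in \<open>u\<close>, \<open>\<omega>\<close> and \<open>qa\<close>; restricting its solution
  to \<open>{a..b}\<close> makes it extensional and thereby unique as a total function.\<close>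

lemma is_state_state:
  assumes \<omega>: "continuous_on {a..b} \<omega>" and u: "pw_continuous a b u"
  shows "is_state a b A B \<omega> qa u (state a b A B \<omega> qa u)"
proof -
  let ?g = "\<lambda>s. B s *v u s + \<omega> s"
  have g: "pw_continuous a b ?g" by (rule pw_continuous_Bu[OF \<omega> u])
  have "continuous_on {a..b} (\<lambda>t. qa + integral {a..t} ?g)"
    by (intro continuous_intros indefinite_integral_continuous_1 pw_continuous_integrable g)
  then obtain q where q: "continuous_on {a..b} q"
    "\<And>t. t \<in> {a..b} \<Longrightarrow> q t = (qa + integral {a..t} ?g) + integral {a..t} (\<lambda>s. A s *v q s)"
    by (rule volterra_equation_solvable[OF A_cont]) blast
  define p where "p = restrict q {a..b}"
  have p_state: "is_state a b A B \<omega> qa u p"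
    unfolding is_state_iff_integral_equation[OF \<omega> u]
  proof (intro conjI ballI)
    show "continuous_on {a..b} p"
      by (rule continuous_on_eq[OF q(1)]) (simp add: p_def)
    fix t assume t: "t \<in> {a..b}"
    then have sub: "{a..t} \<subseteq> {a..b}" by auto
    have "integral {a..t} (\<lambda>s. A s *v p s + B s *v u s + \<omega> s) = integral {a..t} (\<lambda>s. A s *v q s + ?g s)"
      by (rule integral_cong) (use t in \<open>auto simp: p_def\<close>)
    also have "\<dots> = integral {a..t} (\<lambda>s. A s *v q s) + integral {a..t} ?g"
      by (intro integral_add integrable_continuous_real continuous_on_matrix_vector
          continuous_on_subset[OF A_cont sub] continuous_on_subset[OF q(1) sub]
          pw_continuous_integrable pw_continuous_subinterval[OF g sub])
    finally show "p t = qa + integral {a..t} (\<lambda>s. A s *v p s + B s *v u s + \<omega> s)"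
      using q(2)[OF t] t by (simp add: p_def)
  qed
  have "state a b A B \<omega> qa u = p"
    unfolding state_def
  proof (rule the_equality)
    show "p \<in> extensional {a..b} \<and> is_state a b A B \<omega> qa u p" using p_state by (simp add: p_def)
    fix r assume "r \<in> extensional {a..b} \<and> is_state a b A B \<omega> qa u r"
    then show "r = p"
      using is_state_unique[OF \<omega> u _ p_state] by (intro extensionalityI[of r "{a..b}" p]) (auto simp: p_def)
  qed
  with p_state show ?thesis by simp
qed

lemma state_continuous:
  assumes "continuous_on {a..b} \<omega>" "pw_continuous a b u"
  shows "continuous_on {a..b} (state a b A B \<omega> qa u)"
  using is_state_state[OF assms] is_state_iff_integral_equation[OF assms] by blast

lemma state_integral_equation:
  assumes "continuous_on {a..b} \<omega>" "pw_continuous a b u" "t \<in> {a..b}"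
  shows "state a b A B \<omega> qa u t =
    qa + integral {a..t} (\<lambda>s. A s *v state a b A B \<omega> qa u s + B s *v u s + \<omega> s)"
  using is_state_state[OF assms(1,2)] is_state_iff_integral_equation[OF assms(1,2)] assms(3) by blast

text \<open>The linearization of the control-to-state map: the dynamics are affine in the control,
  so the change of state caused by \<open>w\<close> is the state with zero drift and zero initial
  value.\<close>

abbreviation response :: "(real \<Rightarrow> real ^ 'm) \<Rightarrow> real \<Rightarrow> real ^ 'n" where
  "response w \<equiv> state a b A B (\<lambda>t. 0) 0 w"

text \<open>Superposition: the right-hand side solves the integral equation for the perturbed
  control by linearity, and uniqueness identifies it with the state.\<close>

lemma state_add_scaleR:
  assumes \<omega>: "continuous_on {a..b} \<omega>" and u: "pw_continuous a b u" and w: "pw_continuous a b w"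
    and t: "t \<in> {a..b}"
  shows "state a b A B \<omega> qa (\<lambda>t. u t + c *\<^sub>R w t) t = state a b A B \<omega> qa u t + c *\<^sub>R response w t"
proof -
  have z: "continuous_on {a..b} (\<lambda>t. 0 :: real ^ 'n)" by simp
  let ?q = "state a b A B \<omega> qa u"
  have uw: "pw_continuous a b (\<lambda>t. u t + c *\<^sub>R w t)"
    by (intro pw_continuous_add u pw_continuous_scaleR w)
  have "is_state a b A B \<omega> qa (\<lambda>t. u t + c *\<^sub>R w t) (\<lambda>t. ?q t + c *\<^sub>R response w t)"
    unfolding is_state_iff_integral_equation[OF \<omega> uw]
  proof (intro conjI ballI)
    show "continuous_on {a..b} (\<lambda>t. ?q t + c *\<^sub>R response w t)"
      by (intro continuous_intros state_continuous \<omega> u w z)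
    fix r assume r: "r \<in> {a..b}"
    then have sub: "{a..r} \<subseteq> {a..b}" by auto
    let ?f = "\<lambda>s. A s *v ?q s + B s *v u s + \<omega> s"
    let ?g = "\<lambda>s. A s *v response w s + B s *v w s + 0"
    have int: "?f integrable_on {a..r}" "?g integrable_on {a..r}"
      by (intro pw_continuous_integrable pw_continuous_subinterval[OF _ sub] pw_continuous_rhs
          state_continuous \<omega> u w z)+
    have "?q r + c *\<^sub>R response w r = qa + (integral {a..r} ?f + c *\<^sub>R integral {a..r} ?g)"
      using state_integral_equation[OF \<omega> u r, of qa] state_integral_equation[OF z w r, of 0] by simp
    also have "integral {a..r} ?f + c *\<^sub>R integral {a..r} ?g = integral {a..r} (\<lambda>s. ?f s + c *\<^sub>R ?g s)"
      using int by (subst integral_add) (auto intro: integrable_cmul)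
    also have "(\<lambda>s. ?f s + c *\<^sub>R ?g s) = (\<lambda>s. A s *v (?q s + c *\<^sub>R response w s) +
        B s *v (u s + c *\<^sub>R w s) + \<omega> s)"
      by (simp add: matrix_vector_right_distrib matrix_vector_mult_scaleR scaleR_add_right algebra_simps)
    finally show "?q r + c *\<^sub>R response w r = qa + integral {a..r} (\<lambda>s. A s *v (?q s + c *\<^sub>R response w s) +
        B s *v (u s + c *\<^sub>R w s) + \<omega> s)" .
  qed
  then show ?thesis
    using is_state_unique[OF \<omega> uw is_state_state[OF \<omega> uw] _ t] by blast
qed

text \<open>The bound is in terms of the L1 norm, so that a control supported on one sampling
  interval has a response proportional to the length of that interval.\<close>

lemma response_bound:
  obtains K where "0 < K"
    "\<And>w t. pw_continuous a b w \<Longrightarrow> t \<in> {a..b} \<Longrightarrow>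
      norm (response w t) \<le> K * integral {a..b} (\<lambda>s. norm (w s))"
proof -
  have z: "continuous_on {a..b} (\<lambda>t. 0 :: real ^ 'n)" by simp
  obtain K where K: "0 < K" "\<And>g q t. \<lbrakk>pw_continuous a b g; continuous_on {a..b} q;
        \<And>t. t \<in> {a..b} \<Longrightarrow> q t = integral {a..t} (\<lambda>s. A s *v q s + g s); t \<in> {a..b}\<rbrakk>
      \<Longrightarrow> norm (q t) \<le> K * integral {a..b} (\<lambda>s. norm (g s :: real ^ 'n))"
    using integral_equation_estimate by blast
  obtain N where N: "0 < N" "\<forall>t\<in>{a..b}. norm (B t) \<le> N"
    by (rule pw_continuousE[OF continuous_imp_pw_continuous[OF B_cont]])
  show ?thesis
  proof (rule that)
    show "0 < K * N" using K N by simp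
    fix w :: "real \<Rightarrow> real ^ 'm" and t assume w: "pw_continuous a b w" and t: "t \<in> {a..b}"
    have Bw: "pw_continuous a b (\<lambda>s. B s *v w s)"
      by (intro pw_continuous_matrix_vector continuous_imp_pw_continuous[OF B_cont] w)
    have "norm (response w t) \<le> K * integral {a..b} (\<lambda>s. norm (B s *v w s))"
      by (rule K(2)[OF Bw state_continuous[OF z w] _ t])
         (use state_integral_equation[OF z w, of _ 0] in simp)
    also have "integral {a..b} (\<lambda>s. norm (B s *v w s)) \<le> integral {a..b} (\<lambda>s. N * norm (w s))"
    proof (rule integral_le)
      show "(\<lambda>s. norm (B s *v w s)) integrable_on {a..b}"
        by (intro pw_continuous_integrable pw_continuous_norm Bw)
      show "(\<lambda>s. N * norm (w s)) integrable_on {a..b}"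
        by (intro integrable_on_mult_right pw_continuous_integrable pw_continuous_norm w)
      show "norm (B s *v w s) \<le> N * norm (w s)" if "s \<in> {a..b}" for s
        using norm_matrix_vector_le[of "B s" "w s"] N(2) that
        by (meson mult_right_mono norm_ge_zero order_trans)
    qed
    finally show "norm (response w t) \<le> K * N * integral {a..b} (\<lambda>s. norm (w s))"
      using K(1) by simp
  qed
qed

end

subsection \<open>Second-order expansion of the cost\<close>

lemma symmetric_matrix_inner:
  fixes M :: "real ^ 'n ^ 'n"
  assumes "transpose M = M"
  shows "(M *v y) \<bullet> z = (M *v z) \<bullet> y"
  by (metis assms dot_lmul_matrix inner_commute transpose_matrix_vector)

lemma symmetric_quadratic_expand:
  fixes M :: "real ^ 'n ^ 'n"
  assumes "transpose M = M"
  shows "(M *v (y + c *\<^sub>R z)) \<bullet> (y + c *\<^sub>R z) =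
    (M *v y) \<bullet> y + 2 * c * ((M *v y) \<bullet> z) + c\<^sup>2 * ((M *v z) \<bullet> z)"
  using symmetric_matrix_inner[OF assms, of z y]
  by (simp add: matrix_vector_right_distrib matrix_vector_mult_scaleR inner_add_left inner_add_right
      power2_eq_square algebra_simps)

text \<open>Otherwise a small step \<open>c = - D * s\<close> against the sign of \<open>D\<close>
  would make the linear term outweigh the quadratic one. The choice of \<open>s\<close> ensures
  \<open>s * H < 1\<close>, also when \<open>H = 0\<close>.\<close>

lemma linear_coefficient_eq_0:
  fixes D H :: real
  assumes "\<And>c. 0 \<le> c * D + c\<^sup>2 * H"
  shows "D = 0"
proof (rule ccontr)
  assume D: "D \<noteq> 0"
  define s where "s = 1 / (2 * (\<bar>H\<bar> + 1))"
  have s: "s > 0" by (simp add: s_def)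
  have "s * H \<le> s * \<bar>H\<bar>" using s by simp
  also have "\<dots> < 1" by (simp add: s_def field_simps)
  finally have "s * H - 1 < 0" by simp
  then have "(D\<^sup>2 * s) * (s * H - 1) < 0" using D s by (intro mult_pos_neg) auto
  moreover have "(- D * s) * D + (- D * s)\<^sup>2 * H = (D\<^sup>2 * s) * (s * H - 1)"
    by (simp add: power2_eq_square algebra_simps)
  ultimately show False using assms[of "- D * s"] by simp
qed

text \<open>The quadratic form attains a positive minimum on the compact product of
  \<open>{a..b}\<close> with the unit sphere; homogeneity of degree two extends the bound to all
  \<open>y\<close>.\<close>

lemma pos_def_uniform_lower_bound:
  fixes R :: "real \<Rightarrow> real ^ 'm ^ 'm"
  assumes "continuous_on {a..b} R" "\<And>t. t \<in> {a..b} \<Longrightarrow> sym_pos_def (R t)"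
  obtains r where "0 < r" "\<And>t y. t \<in> {a..b} \<Longrightarrow> r * (norm y)\<^sup>2 \<le> (R t *v y) \<bullet> y"
proof (cases "a \<le> b")
  case True
  let ?f = "\<lambda>(t, y). (R t *v y) \<bullet> y"
  let ?X = "{a..b} \<times> sphere (0 :: real ^ 'm) 1"
  have "compact ?X" by (intro compact_Times) auto
  moreover have "?X \<noteq> {}" using True by simp
  moreover have "continuous_on ?X ?f"
    unfolding case_prod_beta
    by (intro continuous_intros bounded_bilinear.continuous_on[OF bounded_bilinear_matrix_vector_mult]
        continuous_on_compose2[OF assms(1)]) auto
  ultimately obtain z where z: "z \<in> ?X" "\<And>p. p \<in> ?X \<Longrightarrow> ?f z \<le> ?f p"
    using continuous_attains_inf by (metis (no_types, lifting))
  obtain t0 y0 where z0: "z = (t0, y0)" "t0 \<in> {a..b}" "norm y0 = 1" using z(1) by auto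
  then have "y0 \<noteq> 0" by auto
  with z0 have "0 < ?f z" using assms(2)[of t0] unfolding sym_pos_def_def by auto
  moreover have "?f z * (norm y)\<^sup>2 \<le> (R t *v y) \<bullet> y" if "t \<in> {a..b}" for t y
  proof (cases "y = 0")
    case False
    then have "?f z \<le> (R t *v (inverse (norm y) *\<^sub>R y)) \<bullet> (inverse (norm y) *\<^sub>R y)"
      using z(2)[of "(t, inverse (norm y) *\<^sub>R y)"] that by simp
    also have "\<dots> = ((R t *v y) \<bullet> y) / (norm y)\<^sup>2"
      by (simp add: matrix_vector_mult_scaleR power2_eq_square field_simps)
    finally show ?thesis using False by (simp add: field_simps)
  qed simp
  ultimately show ?thesis using that by blast
next
  case False
  then show ?thesis using that[of 1] by simp
qed

locale lq_control = linear_control a b A B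
  for a b :: real and A :: "real \<Rightarrow> real ^ 'n ^ 'n" and B :: "real \<Rightarrow> real ^ 'm ^ 'n" +
  fixes qa qb :: "real ^ 'n" and S :: "real ^ 'n ^ 'n" and x \<omega> :: "real \<Rightarrow> real ^ 'n"
    and v :: "real \<Rightarrow> real ^ 'm" and W :: "real \<Rightarrow> real ^ 'n ^ 'n" and R :: "real \<Rightarrow> real ^ 'm ^ 'm"
  assumes S: "sym_pos_semidef S"
    and x_cont: "continuous_on {a..b} x"
    and \<omega>_cont: "continuous_on {a..b} \<omega>"
    and v_cont: "continuous_on {a..b} v"
    and W_cont: "continuous_on {a..b} W"
    and R_cont: "continuous_on {a..b} R"
    and W: "\<And>t. t \<in> {a..b} \<Longrightarrow> sym_pos_semidef (W t)"
    and R: "\<And>t. t \<in> {a..b} \<Longrightarrow> sym_pos_def (R t)"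
begin

abbreviation J :: "(real \<Rightarrow> real ^ 'm) \<Rightarrow> real" where
  "J \<equiv> cost a b A B \<omega> qa qb S W R x v"

abbreviation trajectory :: "(real \<Rightarrow> real ^ 'm) \<Rightarrow> real \<Rightarrow> real ^ 'n" where
  "trajectory u \<equiv> state a b A B \<omega> qa u"

text \<open>The directional derivative of \<open>J\<close> at \<open>u\<close> in direction
  \<open>w\<close>.\<close>

definition dcost :: "(real \<Rightarrow> real ^ 'm) \<Rightarrow> (real \<Rightarrow> real ^ 'm) \<Rightarrow> real" where
  "dcost u w = (S *v (trajectory u b - qb)) \<bullet> response w b +
     integral {a..b} (\<lambda>t. (W t *v (trajectory u t - x t)) \<bullet> response w t + (R t *v (u t - v t)) \<bullet> w t)"

text \<open>The second derivative of \<open>J\<close> as a bilinear form. It involves no base point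
  because \<open>J\<close> is quadratic; the quadratic coefficient in the expansion of
  \<open>J\<close> is half of it.\<close>

definition hess :: "(real \<Rightarrow> real ^ 'm) \<Rightarrow> (real \<Rightarrow> real ^ 'm) \<Rightarrow> real" where
  "hess w z = (S *v response w b) \<bullet> response z b +
     integral {a..b} (\<lambda>t. (W t *v response w t) \<bullet> response z t + (R t *v w t) \<bullet> z t)"

lemma pw_continuous_response: "pw_continuous a b w \<Longrightarrow> pw_continuous a b (response w)"
  by (rule continuous_imp_pw_continuous[OF state_continuous[OF continuous_on_const]])

lemma pw_continuous_deviation: "pw_continuous a b u \<Longrightarrow> pw_continuous a b (\<lambda>t. trajectory u t - x t)"
  by (rule continuous_imp_pw_continuous[OF continuous_on_diff[OF state_continuous[OF \<omega>_cont] x_cont]])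

lemma pw_continuous_control_deviation: "pw_continuous a b u \<Longrightarrow> pw_continuous a b (\<lambda>t. u t - v t)"
  by (intro pw_continuous_diff continuous_imp_pw_continuous[OF v_cont])

lemma pw_continuous_running:
  assumes "pw_continuous a b y" "pw_continuous a b z" "pw_continuous a b f" "pw_continuous a b g"
  shows "pw_continuous a b (\<lambda>t. (W t *v y t) \<bullet> z t + (R t *v f t) \<bullet> g t)"
  by (intro pw_continuous_add pw_continuous_inner pw_continuous_matrix_vector assms
      continuous_imp_pw_continuous[OF W_cont] continuous_imp_pw_continuous[OF R_cont])

lemma J_eq:
  assumes u: "pw_continuous a b u"
  shows "J u = 1/2 * ((S *v (trajectory u b - qb)) \<bullet> (trajectory u b - qb)) +
    1/2 * integral {a..b} (\<lambda>t. (W t *v (trajectory u t - x t)) \<bullet> (trajectory u t - x t) +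
      (R t *v (u t - v t)) \<bullet> (u t - v t))"
  unfolding cost_def Let_def
  by (subst pw_continuous_lebesgue_integral)
     (intro pw_continuous_running pw_continuous_deviation pw_continuous_control_deviation u refl)+

text \<open>The expansion has no remainder: the trajectory is affine in the control and the cost is
  quadratic in trajectory and control.\<close>

lemma J_expand:
  assumes u: "pw_continuous a b u" and w: "pw_continuous a b w"
  shows "J (\<lambda>t. u t + c *\<^sub>R w t) = J u + c * dcost u w + c\<^sup>2 * (hess w w / 2)"
proof -
  let ?q = "trajectory u" and ?\<xi> = "response w"
  have uw: "pw_continuous a b (\<lambda>t. u t + c *\<^sub>R w t)"
    by (intro pw_continuous_add u pw_continuous_scaleR w)
  have traj: "trajectory (\<lambda>t. u t + c *\<^sub>R w t) t - y = (?q t - y) + c *\<^sub>R ?\<xi> t" if "t \<in> {a..b}" for t y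
    using state_add_scaleR[OF \<omega>_cont u w that] by simp
  have WT: "transpose (W t) = W t" and RT: "transpose (R t) = R t" if "t \<in> {a..b}" for t
    using W[OF that] R[OF that] by (auto simp: sym_pos_semidef_def sym_pos_def_def)
  have ST: "transpose S = S" using S by (simp add: sym_pos_semidef_def)
  define f0 where "f0 = (\<lambda>t. (W t *v (?q t - x t)) \<bullet> (?q t - x t) + (R t *v (u t - v t)) \<bullet> (u t - v t))"
  define f1 where "f1 = (\<lambda>t. (W t *v (?q t - x t)) \<bullet> ?\<xi> t + (R t *v (u t - v t)) \<bullet> w t)"
  define f2 where "f2 = (\<lambda>t. (W t *v ?\<xi> t) \<bullet> ?\<xi> t + (R t *v w t) \<bullet> w t)"
  have int: "f0 integrable_on {a..b}" "f1 integrable_on {a..b}" "f2 integrable_on {a..b}"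
    unfolding f0_def f1_def f2_def
    by (intro pw_continuous_integrable pw_continuous_running pw_continuous_deviation
        pw_continuous_control_deviation pw_continuous_response u w)+
  let ?g = "\<lambda>t. (W t *v (trajectory (\<lambda>t. u t + c *\<^sub>R w t) t - x t)) \<bullet>
        (trajectory (\<lambda>t. u t + c *\<^sub>R w t) t - x t) +
      (R t *v (u t + c *\<^sub>R w t - v t)) \<bullet> (u t + c *\<^sub>R w t - v t)"
  have "integral {a..b} ?g = integral {a..b} (\<lambda>t. f0 t + 2 * c * f1 t + c\<^sup>2 * f2 t)"
  proof (rule integral_cong)
    fix t assume t: "t \<in> {a..b}"
    have "u t + c *\<^sub>R w t - v t = (u t - v t) + c *\<^sub>R w t" by simp
    then show "?g t = f0 t + 2 * c * f1 t + c\<^sup>2 * f2 t"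
      unfolding traj[OF t] f0_def f1_def f2_def
      by (simp only: symmetric_quadratic_expand[OF WT[OF t]] symmetric_quadratic_expand[OF RT[OF t]])
        (simp add: algebra_simps)
  qed
  also have "\<dots> = integral {a..b} f0 + 2 * c * integral {a..b} f1 + c\<^sup>2 * integral {a..b} f2"
    using int by (simp add: integral_add integrable_add integrable_on_mult_right)
  finally have I: "integral {a..b} ?g = integral {a..b} f0 + 2 * c * integral {a..b} f1 + c\<^sup>2 * integral {a..b} f2" .
  have b: "b \<in> {a..b}" using ab by simp
  show ?thesis
    unfolding J_eq[OF uw] J_eq[OF u] I dcost_def hess_def traj[OF b] symmetric_quadratic_expand[OF ST]
    unfolding f0_def f1_def f2_def by (simp add: algebra_simps)
qed

text \<open>The derivative of a quadratic functional is affine in the base point, with the Hessian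
  as its linear part. This turns the stationarity of two controls into an orthogonality relation for
  their difference.\<close>

lemma dcost_add:
  assumes u: "pw_continuous a b u" and z: "pw_continuous a b z" and w: "pw_continuous a b w"
  shows "dcost (\<lambda>t. u t + z t) w = dcost u w + hess z w"
proof -
  have traj: "trajectory (\<lambda>t. u t + z t) t - y = (trajectory u t - y) + response z t" if "t \<in> {a..b}" for t y
    using state_add_scaleR[OF \<omega>_cont u z that, of _ 1] by simp
  define f1 where "f1 = (\<lambda>t. (W t *v (trajectory u t - x t)) \<bullet> response w t + (R t *v (u t - v t)) \<bullet> w t)"
  define f2 where "f2 = (\<lambda>t. (W t *v response z t) \<bullet> response w t + (R t *v z t) \<bullet> w t)"
  have int: "f1 integrable_on {a..b}" "f2 integrable_on {a..b}"
    unfolding f1_def f2_def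
    by (intro pw_continuous_integrable pw_continuous_running pw_continuous_deviation
        pw_continuous_control_deviation pw_continuous_response u w z)+
  let ?g = "\<lambda>t. (W t *v (trajectory (\<lambda>t. u t + z t) t - x t)) \<bullet> response w t +
      (R t *v (u t + z t - v t)) \<bullet> w t"
  have "integral {a..b} ?g = integral {a..b} (\<lambda>t. f1 t + f2 t)"
  proof (rule integral_cong)
    fix t assume t: "t \<in> {a..b}"
    have "u t + z t - v t = (u t - v t) + z t" by simp
    then show "?g t = f1 t + f2 t"
      unfolding traj[OF t] f1_def f2_def
      by (simp only: matrix_vector_right_distrib inner_add_left)
  qed
  then have I: "integral {a..b} ?g = integral {a..b} f1 + integral {a..b} f2"
    using int by (simp add: integral_add)
  have b: "b \<in> {a..b}" using ab by simp
  show ?thesis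
    unfolding dcost_def hess_def I traj[OF b] matrix_vector_right_distrib inner_add_left
    unfolding f1_def f2_def by simp
qed

lemma dcost_eq_0_if_minimal:
  assumes "pw_continuous a b u" "pw_continuous a b w" "\<And>c. J u \<le> J (\<lambda>t. u t + c *\<^sub>R w t)"
  shows "dcost u w = 0"
proof (rule linear_coefficient_eq_0)
  show "0 \<le> c * dcost u w + c\<^sup>2 * (hess w w / 2)" for c
    using assms(3)[of c] J_expand[OF assms(1,2), of c] by simp
qed

lemma hess_lower_bound:
  assumes r: "\<And>t y. t \<in> {a..b} \<Longrightarrow> r * (norm y)\<^sup>2 \<le> (R t *v y) \<bullet> y"
    and w: "pw_continuous a b w"
  shows "r * integral {a..b} (\<lambda>t. (norm (w t))\<^sup>2) \<le> hess w w"
proof -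
  have "integral {a..b} (\<lambda>t. r * (norm (w t))\<^sup>2) \<le>
      integral {a..b} (\<lambda>t. (W t *v response w t) \<bullet> response w t + (R t *v w t) \<bullet> w t)"
  proof (rule integral_le)
    show "(\<lambda>t. r * (norm (w t))\<^sup>2) integrable_on {a..b}"
      unfolding power2_norm_eq_inner
      by (intro integrable_on_mult_right pw_continuous_integrable pw_continuous_inner w)
    show "(\<lambda>t. (W t *v response w t) \<bullet> response w t + (R t *v w t) \<bullet> w t) integrable_on {a..b}"
      by (intro pw_continuous_integrable pw_continuous_running pw_continuous_response w)
    show "r * (norm (w t))\<^sup>2 \<le> (W t *v response w t) \<bullet> response w t + (R t *v w t) \<bullet> w t"
      if "t \<in> {a..b}" for t
      using r[OF that, of "w t"] W[OF that] by (auto simp: sym_pos_semidef_def intro: add_increasing)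
  qed
  moreover have "0 \<le> (S *v response w b) \<bullet> response w b" using S by (simp add: sym_pos_semidef_def)
  ultimately show ?thesis unfolding hess_def by simp
qed

text \<open>Apart from the term with \<open>R\<close>, the Hessian sees the controls only through
  their responses, each of which is bounded by an L1 norm. Products of L1 norms are what makes this
  part small against test controls living on a single sampling interval.\<close>

lemma hess_state_part_bound:
  obtains K where "0 < K"
    "\<And>w z. pw_continuous a b w \<Longrightarrow> pw_continuous a b z \<Longrightarrow>
      \<bar>hess w z - integral {a..b} (\<lambda>t. (R t *v w t) \<bullet> z t)\<bar> \<le>
        K * integral {a..b} (\<lambda>t. norm (w t)) * integral {a..b} (\<lambda>t. norm (z t))"
proof -
  obtain K where K: "0 < K" "\<And>w t. pw_continuous a b w \<Longrightarrow> t \<in> {a..b} \<Longrightarrow>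
      norm (response w t) \<le> K * integral {a..b} (\<lambda>s. norm (w s))"
    using response_bound by blast
  obtain N where N: "0 < N" "\<forall>t\<in>{a..b}. norm (W t) \<le> N"
    by (rule pw_continuousE[OF continuous_imp_pw_continuous[OF W_cont]])
  show ?thesis
  proof (rule that)
    show "0 < (norm S + N * (b - a)) * K\<^sup>2"
      using K N ab by (intro mult_pos_pos add_nonneg_pos) auto
    fix w z :: "real \<Rightarrow> real ^ 'm" assume w: "pw_continuous a b w" and z: "pw_continuous a b z"
    let ?w = "integral {a..b} (\<lambda>t. norm (w t))" and ?z = "integral {a..b} (\<lambda>t. norm (z t))"
    have nonneg: "0 \<le> ?w" "0 \<le> ?z"
      by (intro integral_nonneg pw_continuous_integrable pw_continuous_norm w z norm_ge_zero)+
    have bound: "\<bar>(M *v response w t) \<bullet> response z t\<bar> \<le> norm M * (K\<^sup>2 * ?w * ?z)" if t: "t \<in> {a..b}" for M t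
    proof -
      have "\<bar>(M *v response w t) \<bullet> response z t\<bar> \<le> norm (M *v response w t) * norm (response z t)"
        by (rule Cauchy_Schwarz_ineq2)
      also have "\<dots> \<le> (norm M * norm (response w t)) * norm (response z t)"
        by (intro mult_right_mono norm_matrix_vector_le) simp
      also have "\<dots> \<le> (norm M * (K * ?w)) * (K * ?z)"
        using K(1) nonneg by (intro mult_mono mult_left_mono K(2) w z t) auto
      also have "\<dots> = norm M * (K\<^sup>2 * ?w * ?z)" by (simp add: power2_eq_square)
      finally show ?thesis .
    qed
    let ?f = "\<lambda>t. (W t *v response w t) \<bullet> response z t"
    have pf: "pw_continuous a b ?f" and pR: "pw_continuous a b (\<lambda>t. (R t *v w t) \<bullet> z t)"
      by (intro pw_continuous_inner pw_continuous_matrix_vector pw_continuous_response w z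
          continuous_imp_pw_continuous[OF W_cont] continuous_imp_pw_continuous[OF R_cont])+
    have "0 \<le> K\<^sup>2 * ?w * ?z" using nonneg by simp
    then have "norm (?f t) \<le> N * (K\<^sup>2 * ?w * ?z)" if "t \<in> {a..b}" for t
      using bound[OF that, of "W t"] N that by (force intro: order_trans mult_right_mono)
    then have "norm (integral {a..b} ?f) \<le> integral {a..b} (\<lambda>_. N * (K\<^sup>2 * ?w * ?z))"
      by (intro integral_norm_bound_integral pw_continuous_integrable[OF pf]) auto
    then have 1: "\<bar>integral {a..b} ?f\<bar> \<le> N * (b - a) * (K\<^sup>2 * ?w * ?z)"
      using ab by (simp add: algebra_simps)
    have 2: "\<bar>(S *v response w b) \<bullet> response z b\<bar> \<le> norm S * (K\<^sup>2 * ?w * ?z)"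
      using ab by (intro bound) simp
    have "hess w z - integral {a..b} (\<lambda>t. (R t *v w t) \<bullet> z t) = (S *v response w b) \<bullet> response z b + integral {a..b} ?f"
      unfolding hess_def by (subst integral_add) (auto intro: pw_continuous_integrable pf pR)
    then have "\<bar>hess w z - integral {a..b} (\<lambda>t. (R t *v w t) \<bullet> z t)\<bar> \<le>
        norm S * (K\<^sup>2 * ?w * ?z) + N * (b - a) * (K\<^sup>2 * ?w * ?z)"
      using 1 2 by linarith
    also have "\<dots> = (norm S + N * (b - a)) * K\<^sup>2 * ?w * ?z" by (simp add: algebra_simps)
    finally show "\<bar>hess w z - integral {a..b} (\<lambda>t. (R t *v w t) \<bullet> z t)\<bar> \<le>
        (norm S + N * (b - a)) * K\<^sup>2 * ?w * ?z" .
  qed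
qed

end

subsection \<open>Sampling\<close>

lemma sample_time_0 [simp]: "sample_time a h 0 = a"
  by (simp add: sample_time_def)

lemma sample_time_Suc: "sample_time a h (Suc i) = sample_time a h i + h ! i"
  by (simp add: sample_time_def)

lemma sample_time_length: "h \<in> partitions a b \<Longrightarrow> sample_time a h (length h) = b"
  by (simp add: sample_time_def partitions_def)

lemma sample_time_mono:
  assumes h: "h \<in> partitions a b" and ij: "i \<le> j" "j \<le> length h"
  shows "sample_time a h i \<le> sample_time a h j"
  using ij
proof (induction rule: dec_induct)
  case (step n)
  then have "0 < h ! n" using h by (simp add: partitions_def)
  with step show ?case by (simp add: sample_time_Suc)
qed simp

lemma step_le_mesh: "i < length h \<Longrightarrow> h ! i \<le> mesh h"
  by (simp add: mesh_def)

lemma sample_interval_exists: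
  assumes h: "h \<in> partitions a b" and t: "t \<in> {a..<b}"
  obtains i where "i < length h" "t \<in> {sample_time a h i..<sample_time a h (Suc i)}"
proof -
  have "\<exists>i<n. t \<in> {sample_time a h i..<sample_time a h (Suc i)}" if "t < sample_time a h n" for n
    using that
  proof (induction n)
    case (Suc n)
    show ?case
    proof (cases "t < sample_time a h n")
      case True
      with Suc.IH show ?thesis by (meson less_SucI)
    next
      case False
      with Suc.prems show ?thesis by (intro exI[of _ n]) auto
    qed
  qed (use t in simp)
  from this[of "length h"] show ?thesis
    using that t sample_time_length[OF h] by auto
qed

text \<open>Since the sampling times increase, the interval containing \<open>t\<close> is
  identified by the last sampling time not exceeding \<open>t\<close>. This yields disjointness of
  the sampling intervals and the evaluation of \<open>sample_hold\<close>.\<close>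

lemma sample_time_le_iff:
  assumes h: "h \<in> partitions a b" and i: "i < length h" "j < length h"
    and t: "t \<in> {sample_time a h i..<sample_time a h (Suc i)}"
  shows "sample_time a h j \<le> t \<longleftrightarrow> j \<le> i"
proof
  assume "sample_time a h j \<le> t"
  then have "\<not> sample_time a h (Suc i) \<le> sample_time a h j" using t by auto
  then show "j \<le> i" using sample_time_mono[OF h, of "Suc i" j] i by (meson less_imp_le not_less_eq_eq)
next
  assume "j \<le> i"
  then show "sample_time a h j \<le> t" using sample_time_mono[OF h, of j i] i t by auto
qed

lemma sampled_controls_pw_continuous:
  fixes u :: "real \<Rightarrow> 'e::real_normed_vector"
  assumes h: "h \<in> partitions a b" and u: "u \<in> sampled_controls a h"
  shows "pw_continuous a b u"
proof -
  let ?s = "sample_time a h"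
  have "\<forall>i<length h. \<exists>y. \<forall>t\<in>{?s i..<?s (Suc i)}. u t = y"
    using u by (simp add: sampled_controls_def constant_on_def)
  then obtain y where y: "\<And>i t. i < length h \<Longrightarrow> t \<in> {?s i..<?s (Suc i)} \<Longrightarrow> u t = y i"
    by metis
  \<comment> \<open>The value at \<open>b\<close> is listed separately because no half-open sampling
    interval contains \<open>b\<close>.\<close>
  have "u ` {a..b} \<subseteq> insert (u b) (y ` {..<length h})"
  proof (rule image_subsetI)
    fix t assume t: "t \<in> {a..b}"
    show "u t \<in> insert (u b) (y ` {..<length h})"
    proof (cases "t = b")
      case False
      then obtain i where "i < length h" "t \<in> {?s i..<?s (Suc i)}"
        using sample_interval_exists[OF h, of t] t by auto
      then show ?thesis using y by auto
    qed simp
  qed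
  then have "bounded (u ` {a..b})" by (rule bounded_subset[rotated]) (simp add: finite_imp_bounded)
  moreover have "continuous_on ({a..b} - ?s ` {..length h}) u"
  proof (rule continuous_at_imp_continuous_on, rule ballI)
    fix t assume t: "t \<in> {a..b} - ?s ` {..length h}"
    then have "t \<noteq> b" using sample_time_length[OF h] by force
    then obtain i where i: "i < length h" "t \<in> {?s i..<?s (Suc i)}"
      using sample_interval_exists[OF h, of t] t by auto
    then have "t \<noteq> ?s i" using t by auto
    then have "t \<in> {?s i<..<?s (Suc i)}" using i by auto
    moreover have "continuous_on {?s i<..<?s (Suc i)} u"
      by (rule continuous_on_eq[of _ "\<lambda>_. y i"]) (use y[OF i(1)] in auto)
    ultimately show "isCont u t" by (simp add: continuous_on_eq_continuous_at)
  qed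
  moreover have "finite (?s ` {..length h})" by simp
  ultimately show ?thesis unfolding pw_continuous_def by blast
qed

lemma sampled_controls_add_scaleR:
  fixes u :: "real \<Rightarrow> 'e::real_vector"
  assumes "u \<in> sampled_controls a h" "w \<in> sampled_controls a h"
  shows "(\<lambda>t. u t + c *\<^sub>R w t) \<in> sampled_controls a h"
  using assms unfolding sampled_controls_def constant_on_def by simp metis

text \<open>Provides the test controls that localize the stationarity condition to one sampling
  interval.\<close>

lemma indicator_in_sampled_controls:
  fixes c :: "'e::real_vector"
  assumes h: "h \<in> partitions a b" and i: "i < length h"
  shows "(\<lambda>t. indicat_real {sample_time a h i..<sample_time a h (Suc i)} t *\<^sub>R c) \<in> sampled_controls a h"
  unfolding sampled_controls_def constant_on_def mem_Collect_eq
proof (intro allI impI)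
  fix j assume j: "j < length h"
  have "t \<notin> {sample_time a h i..<sample_time a h (Suc i)}"
    if "i \<noteq> j" "t \<in> {sample_time a h j..<sample_time a h (Suc j)}" for t
    using that sample_time_le_iff[OF h i j, of t] sample_time_le_iff[OF h j i, of t] by auto
  then show "\<exists>y. \<forall>t\<in>{sample_time a h j..<sample_time a h (Suc j)}.
      indicat_real {sample_time a h i..<sample_time a h (Suc i)} t *\<^sub>R c = y"
    by (cases "i = j") (auto simp: indicator_def)
qed

text \<open>Selecting the sample by \<open>Max\<close> also gives a sensible value at
  \<open>b\<close>: all indices qualify there, so the last sample is held. The error estimate can
  therefore cover the closed interval.\<close>

definition sample_hold :: "real \<Rightarrow> real list \<Rightarrow> (real \<Rightarrow> 'e) \<Rightarrow> real \<Rightarrow> 'e" where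
  "sample_hold a h u t = u (sample_time a h (Max {j. j < length h \<and> sample_time a h j \<le> t}))"

lemma sample_hold_eq:
  assumes "h \<in> partitions a b" "i < length h" "t \<in> {sample_time a h i..<sample_time a h (Suc i)}"
  shows "sample_hold a h u t = u (sample_time a h i)"
proof -
  have "{j. j < length h \<and> sample_time a h j \<le> t} = {..i}"
    using sample_time_le_iff[OF assms(1,2) _ assms(3)] assms(2) by auto
  moreover have "Max {..i} = i" by (rule Max_eqI) auto
  ultimately show ?thesis by (simp add: sample_hold_def)
qed

lemma sample_hold_end:
  assumes h: "h \<in> partitions a b"
  shows "sample_hold a h u b = u (sample_time a h (length h - 1))"
proof -
  have N: "length h \<noteq> 0" using h by (simp add: partitions_def)
  have "sample_time a h j \<le> b" if "j < length h" for j
    using sample_time_mono[OF h, of j "length h"] sample_time_length[OF h] that by simp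
  moreover have "j < length h \<longleftrightarrow> j \<le> length h - 1" for j using N by linarith
  ultimately have "{j. j < length h \<and> sample_time a h j \<le> b} = {..length h - 1}" by blast
  moreover have "Max {..length h - 1} = length h - 1" by (rule Max_eqI) auto
  ultimately show ?thesis by (simp add: sample_hold_def)
qed

lemma sample_hold_in_sampled_controls:
  "h \<in> partitions a b \<Longrightarrow> sample_hold a h u \<in> sampled_controls a h"
  unfolding sampled_controls_def constant_on_def by (auto simp: sample_hold_eq)

lemma sample_hold_error:
  fixes u :: "real \<Rightarrow> 'e::real_normed_vector"
  assumes h: "h \<in> partitions a b" and t: "t \<in> {a..b}"
    and osc: "\<And>s t. s \<in> {a..b} \<Longrightarrow> t \<in> {a..b} \<Longrightarrow> \<bar>s - t\<bar> \<le> mesh h \<Longrightarrow> norm (u s - u t) \<le> \<eta>"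
  shows "norm (sample_hold a h u t - u t) \<le> \<eta>"
proof -
  have "\<exists>i<length h. sample_hold a h u t = u (sample_time a h i) \<and>
      sample_time a h i \<le> t \<and> t \<le> sample_time a h (Suc i)"
  proof (cases "t = b")
    case True
    have N: "length h \<noteq> 0" using h by (simp add: partitions_def)
    then have "sample_time a h (Suc (length h - 1)) = b" using sample_time_length[OF h] by simp
    moreover have "sample_time a h (length h - 1) \<le> b"
      using sample_time_mono[OF h, of "length h - 1" "length h"] sample_time_length[OF h] by simp
    ultimately show ?thesis using True N sample_hold_end[OF h, of u] by (intro exI[of _ "length h - 1"]) auto
  next
    case False
    then obtain i where "i < length h" "t \<in> {sample_time a h i..<sample_time a h (Suc i)}"
      using sample_interval_exists[OF h, of t] t by auto
    then show ?thesis using sample_hold_eq[OF h] by (intro exI[of _ i]) auto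
  qed
  then obtain i where i: "i < length h" "sample_hold a h u t = u (sample_time a h i)"
    "sample_time a h i \<le> t" "t \<le> sample_time a h (Suc i)" by blast
  have "a \<le> sample_time a h i" using sample_time_mono[OF h, of 0 i] i by simp
  moreover have "\<bar>sample_time a h i - t\<bar> \<le> mesh h"
    using i step_le_mesh[OF i(1)] by (simp add: sample_time_Suc)
  ultimately show ?thesis unfolding i(2) using i t by (intro osc) auto
qed

lemma integral_indicator_Ico:
  assumes "a \<le> c" "c \<le> d" "d \<le> b"
  shows "integral {a..b} (indicat_real {c..<d}) = d - c"
proof -
  have "{c..<d} \<inter> {a..b} = {c..<d}" using assms by auto
  moreover have "{c..<d} \<in> lmeasurable"
    by (rule bounded_set_imp_lmeasurable) (auto intro: bounded_subset[of "{c..d}"])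
  ultimately show ?thesis using integral_indicator[of "{c..<d}" "{a..b}"] assms by simp
qed

section \<open>Stationarity of the two optima and the pointwise error estimate\<close>

context lq_control
begin

lemma permanent_stationary:
  assumes "is_arg_min J (\<lambda>u. u \<in> L2_on a b) u" "pw_continuous a b u" "pw_continuous a b w"
  shows "dcost u w = 0"
proof (rule dcost_eq_0_if_minimal[OF assms(2,3)])
  fix c
  have "(\<lambda>t. u t + c *\<^sub>R w t) \<in> L2_on a b"
    by (intro pw_continuous_in_L2 pw_continuous_add pw_continuous_scaleR assms)
  then show "J u \<le> J (\<lambda>t. u t + c *\<^sub>R w t)"
    using assms(1) unfolding is_arg_min_def by force
qed

text \<open>Sampled controls on a fixed partition form a linear space, so steps of either sign in
  direction \<open>w\<close> remain admissible.\<close>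

lemma sampled_stationary:
  assumes "h \<in> partitions a b" "is_arg_min J (\<lambda>u. u \<in> sampled_controls a h) u" "w \<in> sampled_controls a h"
  shows "dcost u w = 0"
proof (rule dcost_eq_0_if_minimal)
  have u: "u \<in> sampled_controls a h" using assms(2) by (simp add: is_arg_min_def)
  show "pw_continuous a b u" "pw_continuous a b w"
    using sampled_controls_pw_continuous[OF assms(1)] u assms(3) by blast+
  show "J u \<le> J (\<lambda>t. u t + c *\<^sub>R w t)" for c
    using assms(2) sampled_controls_add_scaleR[OF u assms(3), of c] unfolding is_arg_min_def by force
qed

text \<open>The constant depends neither on the partition nor on \<open>\<eta>\<close> or
  \<open>t\<close>: the pointwise error is at most a fixed multiple of the oscillation of
  \<open>u\<close> at the scale of the mesh.\<close>

lemma sampled_error_bound: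
  assumes u: "continuous_on {a..b} u" "is_arg_min J (\<lambda>u. u \<in> L2_on a b) u"
  obtains C where "0 < C"
    "\<And>h uh \<eta> t. \<lbrakk>h \<in> partitions a b; is_arg_min J (\<lambda>u. u \<in> sampled_controls a h) uh; 0 < \<eta>;
        \<And>s t. s \<in> {a..b} \<Longrightarrow> t \<in> {a..b} \<Longrightarrow> \<bar>s - t\<bar> \<le> mesh h \<Longrightarrow> norm (u s - u t) \<le> \<eta>;
        t \<in> {a..<b}\<rbrakk> \<Longrightarrow> norm (uh t - u t) \<le> C * \<eta>"
proof -
  obtain r where r: "0 < r" "\<And>t y. t \<in> {a..b} \<Longrightarrow> r * (norm y)\<^sup>2 \<le> (R t *v y) \<bullet> y"
    using pos_def_uniform_lower_bound[OF R_cont R] by blast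
  obtain M where M: "0 < M" "\<forall>t\<in>{a..b}. norm (R t) \<le> M"
    by (rule pw_continuousE[OF continuous_imp_pw_continuous[OF R_cont]])
  obtain K where K: "0 < K" "\<And>w z. pw_continuous a b w \<Longrightarrow> pw_continuous a b z \<Longrightarrow>
      \<bar>hess w z - integral {a..b} (\<lambda>t. (R t *v w t) \<bullet> z t)\<bar> \<le>
        K * integral {a..b} (\<lambda>t. norm (w t)) * integral {a..b} (\<lambda>t. norm (z t))"
    using hess_state_part_bound by blast
  have Rle: "\<bar>(R t *v y) \<bullet> z\<bar> \<le> M * norm y * norm z" if "t \<in> {a..b}" for t y z
  proof -
    have "\<bar>(R t *v y) \<bullet> z\<bar> \<le> norm (R t *v y) * norm z" by (rule Cauchy_Schwarz_ineq2)
    also have "\<dots> \<le> (norm (R t) * norm y) * norm z"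
      by (intro mult_right_mono norm_matrix_vector_le) simp
    also have "\<dots> \<le> M * norm y * norm z" using M that by (intro mult_right_mono) auto
    finally show ?thesis .
  qed
  \<comment> \<open>\<open>C1 * \<eta>\<^sup>2\<close> will bound \<open>hess d d\<close>,
    \<open>C2 * \<eta>\<close> will bound the L1 norm of \<open>e\<close>, and
    \<open>C * \<eta>\<close> results from dividing the localized inequality by
    \<open>r\<close>.\<close>
  define C1 where "C1 = K * (b - a)\<^sup>2 + M * (b - a)"
  define C2 where "C2 = (C1 / r + (b - a)) / 2"
  define C where "C = (M + K * C2) / r"
  have C1: "0 < C1" unfolding C1_def using K M ab by (intro add_pos_pos) auto
  have C2: "0 < C2" unfolding C2_def using C1 r ab by (simp add: add_pos_pos)
  have pu: "pw_continuous a b u" by (rule continuous_imp_pw_continuous[OF u(1)])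
  show ?thesis
  proof (rule that)
    show "0 < C" unfolding C_def using M K C2 r by (simp add: add_pos_pos)
    fix h uh \<eta> t0
    assume h: "h \<in> partitions a b" and uh: "is_arg_min J (\<lambda>u. u \<in> sampled_controls a h) uh"
      and \<eta>: "0 < \<eta>"
      and osc: "\<And>s t. s \<in> {a..b} \<Longrightarrow> t \<in> {a..b} \<Longrightarrow> \<bar>s - t\<bar> \<le> mesh h \<Longrightarrow> norm (u s - u t) \<le> \<eta>"
      and t0: "t0 \<in> {a..<b}"
    have uh_in: "uh \<in> sampled_controls a h" using uh by (simp add: is_arg_min_def)
    have puh: "pw_continuous a b uh" by (rule sampled_controls_pw_continuous[OF h uh_in])
    define e where "e = (\<lambda>t. uh t - u t)"
    define p where "p = sample_hold a h u"
    define d where "d = (\<lambda>t. p t - u t)"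
    have p_in: "p \<in> sampled_controls a h" unfolding p_def by (rule sample_hold_in_sampled_controls[OF h])
    have pp: "pw_continuous a b p" by (rule sampled_controls_pw_continuous[OF h p_in])
    have pe: "pw_continuous a b e" unfolding e_def by (intro pw_continuous_diff puh pu)
    have pd: "pw_continuous a b d" unfolding d_def by (intro pw_continuous_diff pp pu)
    have d_le: "norm (d t) \<le> \<eta>" if "t \<in> {a..b}" for t
      unfolding d_def p_def by (rule sample_hold_error[OF h that osc])
    have orth: "hess e w = 0" if w: "w \<in> sampled_controls a h" for w
    proof -
      have pw: "pw_continuous a b w" by (rule sampled_controls_pw_continuous[OF h w])
      have "dcost uh w = dcost u w + hess e w"
        using dcost_add[OF pu pe pw] by (simp add: e_def)
      then show ?thesis
        using sampled_stationary[OF h uh w] permanent_stationary[OF u(2) pu pw] by simp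
    qed
    \<comment> \<open>\<open>p\<close> competes with \<open>uh\<close> among the sampled controls.
      Both costs are expanded around \<open>u\<close>, where the first-order terms vanish, so the
      comparison of costs becomes one of Hessians.\<close>
    have "J uh \<le> J p" using uh p_in unfolding is_arg_min_def by force
    moreover have "J uh = J u + hess e e / 2"
      using J_expand[OF pu pe, of 1] permanent_stationary[OF u(2) pu pe] by (simp add: e_def)
    moreover have "J p = J u + hess d d / 2"
      using J_expand[OF pu pd, of 1] permanent_stationary[OF u(2) pu pd] by (simp add: d_def)
    ultimately have "hess e e \<le> hess d d" by simp
    also have "\<dots> \<le> C1 * \<eta>\<^sup>2"
    proof -
      have "integral {a..b} (\<lambda>t. norm (d t)) \<le> integral {a..b} (\<lambda>_. \<eta>)"
        by (intro integral_le pw_continuous_integrable pw_continuous_norm pd pw_continuous_const d_le)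
      then have nd: "integral {a..b} (\<lambda>t. norm (d t)) \<le> (b - a) * \<eta>" using ab by simp
      have nd0: "0 \<le> integral {a..b} (\<lambda>t. norm (d t))"
        by (intro integral_nonneg pw_continuous_integrable pw_continuous_norm pd norm_ge_zero)
      have "integral {a..b} (\<lambda>t. (R t *v d t) \<bullet> d t) \<le> integral {a..b} (\<lambda>_. M * \<eta> * \<eta>)"
      proof (rule integral_le)
        show "(\<lambda>t. (R t *v d t) \<bullet> d t) integrable_on {a..b}"
          by (intro pw_continuous_integrable pw_continuous_inner pw_continuous_matrix_vector pd
              continuous_imp_pw_continuous[OF R_cont])
        fix t assume t: "t \<in> {a..b}"
        have "(R t *v d t) \<bullet> d t \<le> M * norm (d t) * norm (d t)" using Rle[OF t, of "d t" "d t"] by simp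
        also have "\<dots> \<le> M * \<eta> * \<eta>" using d_le[OF t] M \<eta> by (intro mult_mono) auto
        finally show "(R t *v d t) \<bullet> d t \<le> M * \<eta> * \<eta>" .
      qed auto
      then have "integral {a..b} (\<lambda>t. (R t *v d t) \<bullet> d t) \<le> M * (b - a) * \<eta>\<^sup>2"
        using ab by (simp add: power2_eq_square algebra_simps)
      moreover have "K * integral {a..b} (\<lambda>t. norm (d t)) * integral {a..b} (\<lambda>t. norm (d t))
          \<le> K * ((b - a) * \<eta>) * ((b - a) * \<eta>)"
        using nd nd0 K \<eta> ab by (intro mult_mono) auto
      ultimately have "hess d d \<le> K * ((b - a) * \<eta>) * ((b - a) * \<eta>) + M * (b - a) * \<eta>\<^sup>2"
        using K(2)[OF pd pd] by linarith
      then show ?thesis by (simp add: C1_def power2_eq_square algebra_simps)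
    qed
    finally have "r * integral {a..b} (\<lambda>t. (norm (e t))\<^sup>2) \<le> C1 * \<eta>\<^sup>2"
      using hess_lower_bound[OF r(2) pe] by linarith
    then have e2: "integral {a..b} (\<lambda>t. (norm (e t))\<^sup>2) \<le> C1 / r * \<eta>\<^sup>2"
      using r(1) by (simp add: pos_le_divide_eq mult.commute)
    have e1: "integral {a..b} (\<lambda>t. norm (e t)) \<le> C2 * \<eta>"
    proof -
      have int: "(\<lambda>t. (norm (e t))\<^sup>2) integrable_on {a..b}"
        unfolding power2_norm_eq_inner by (intro pw_continuous_integrable pw_continuous_inner pe)
      \<comment> \<open>The inequality between arithmetic and geometric means with weight
        \<open>\<eta>\<close> replaces Cauchy-Schwarz in passing from the squared L2 norm to the L1
        norm; the common factor \<open>2 * \<eta>\<close> is cancelled at the end.\<close>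
      have "integral {a..b} (\<lambda>t. 2 * \<eta> * norm (e t)) \<le> integral {a..b} (\<lambda>t. (norm (e t))\<^sup>2 + \<eta>\<^sup>2)"
      proof (rule integral_le)
        show "(\<lambda>t. 2 * \<eta> * norm (e t)) integrable_on {a..b}"
          by (intro integrable_on_mult_right pw_continuous_integrable pw_continuous_norm pe)
        show "(\<lambda>t. (norm (e t))\<^sup>2 + \<eta>\<^sup>2) integrable_on {a..b}"
          using int by (intro integrable_add) auto
        show "2 * \<eta> * norm (e t) \<le> (norm (e t))\<^sup>2 + \<eta>\<^sup>2" for t
          using sum_squares_bound[of \<eta> "norm (e t)"] by simp
      qed
      also have "\<dots> = integral {a..b} (\<lambda>t. (norm (e t))\<^sup>2) + (b - a) * \<eta>\<^sup>2"
        using int ab by (subst integral_add) auto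
      also have "\<dots> \<le> C1 / r * \<eta>\<^sup>2 + (b - a) * \<eta>\<^sup>2" using e2 by simp
      also have "\<dots> = 2 * \<eta> * (C2 * \<eta>)" by (simp add: C2_def power2_eq_square field_simps)
      finally show ?thesis using \<eta> by simp
    qed
    obtain i where i: "i < length h" "t0 \<in> {sample_time a h i..<sample_time a h (Suc i)}"
      by (rule sample_interval_exists[OF h t0])
    define I where "I = {sample_time a h i..<sample_time a h (Suc i)}"
    define c where "c = uh t0 - u t0"
    \<comment> \<open>The test control takes the constant value \<open>e t0\<close> on the sampling
      interval of \<open>t0\<close> and vanishes elsewhere, so its L1 norm is
      \<open>L * norm c\<close>.\<close>
    define w where "w = (\<lambda>t. indicat_real I t *\<^sub>R c)"
    define L where "L = integral {a..b} (indicat_real I)"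
    have bounds: "a \<le> sample_time a h i" "sample_time a h (Suc i) \<le> b"
      using sample_time_mono[OF h, of 0 i] sample_time_mono[OF h, of "Suc i" "length h"]
        sample_time_length[OF h] i by auto
    have sub: "I \<subseteq> {a..b}" using bounds by (auto simp: I_def)
    have "L = sample_time a h (Suc i) - sample_time a h i"
      unfolding L_def I_def using bounds i by (intro integral_indicator_Ico) auto
    then have L: "0 < L" using i by auto
    have w_in: "w \<in> sampled_controls a h"
      unfolding w_def I_def by (rule indicator_in_sampled_controls[OF h i(1)])
    have pw: "pw_continuous a b w" by (rule sampled_controls_pw_continuous[OF h w_in])
    have "indicat_real I \<in> sampled_controls a h"
      using indicator_in_sampled_controls[OF h i(1), of "1 :: real"] by (simp add: I_def)
    then have pI: "pw_continuous a b (indicat_real I)" by (rule sampled_controls_pw_continuous[OF h])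
    have w1: "integral {a..b} (\<lambda>t. norm (w t)) = L * norm c"
      unfolding w_def L_def by simp
    have const: "uh t = uh t0" if "t \<in> I" for t
      using uh_in i that by (auto simp: sampled_controls_def constant_on_def I_def)
    \<comment> \<open>On \<open>I\<close> the control \<open>uh\<close> is constant, so
      \<open>e t\<close> differs from \<open>c\<close> only by \<open>u t0 - u t\<close>, of norm at
      most \<open>\<eta>\<close>. Positivity of \<open>R\<close> bounds the main term from below,
      and \<open>M\<close> bounds the perturbation.\<close>
    have "L * (r * (norm c)\<^sup>2 - M * \<eta> * norm c) =
        integral {a..b} (\<lambda>t. indicat_real I t * (r * (norm c)\<^sup>2 - M * \<eta> * norm c))"
      by (simp add: L_def)
    also have "\<dots> \<le> integral {a..b} (\<lambda>t. (R t *v e t) \<bullet> w t)"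
    proof (rule integral_le)
      show "(\<lambda>t. indicat_real I t * (r * (norm c)\<^sup>2 - M * \<eta> * norm c)) integrable_on {a..b}"
        by (intro integrable_on_mult_left pw_continuous_integrable pI)
      show "(\<lambda>t. (R t *v e t) \<bullet> w t) integrable_on {a..b}"
        by (intro pw_continuous_integrable pw_continuous_inner pw_continuous_matrix_vector pe pw
            continuous_imp_pw_continuous[OF R_cont])
      fix t assume t: "t \<in> {a..b}"
      show "indicat_real I t * (r * (norm c)\<^sup>2 - M * \<eta> * norm c) \<le> (R t *v e t) \<bullet> w t"
      proof (cases "t \<in> I")
        case True
        have "\<bar>t0 - t\<bar> \<le> mesh h"
          using True i step_le_mesh[OF i(1)] by (auto simp: I_def sample_time_Suc)
        then have "norm (u t0 - u t) \<le> \<eta>" using t0 t by (intro osc) auto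
        then have "M * norm (u t0 - u t) * norm c \<le> M * \<eta> * norm c"
          using M by (intro mult_right_mono mult_left_mono) auto
        moreover have "e t = c + (u t0 - u t)" using const[OF True] by (simp add: e_def c_def)
        then have "(R t *v e t) \<bullet> c = (R t *v c) \<bullet> c + (R t *v (u t0 - u t)) \<bullet> c"
          by (simp only: matrix_vector_right_distrib inner_add_left)
        ultimately have "r * (norm c)\<^sup>2 - M * \<eta> * norm c \<le> (R t *v e t) \<bullet> c"
          using r(2)[OF t, of c] Rle[OF t, of "u t0 - u t" c] by linarith
        then show ?thesis using True by (simp add: w_def)
      qed (simp add: w_def)
    qed
    \<comment> \<open>As \<open>hess e w = 0\<close>, the control part is the negative of the state
      part, which is bounded by L1 norms.\<close>
    also have "\<dots> \<le> K * integral {a..b} (\<lambda>t. norm (e t)) * integral {a..b} (\<lambda>t. norm (w t))"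
      using K(2)[OF pe pw] orth[OF w_in] by simp
    also have "\<dots> \<le> K * (C2 * \<eta>) * (L * norm c)"
      unfolding w1 using e1 K L by (intro mult_right_mono mult_left_mono) auto
    \<comment> \<open>Both sides carry the factor \<open>L * norm c\<close>. Cancelling
      \<open>L\<close> removes the dependence on the interval length, and cancelling
      \<open>norm c\<close> leaves a linear bound; the case \<open>c = 0\<close> is trivial.\<close>
    finally have "L * (norm c * (r * norm c)) \<le> L * (norm c * ((M + K * C2) * \<eta>))"
      by (simp add: power2_eq_square algebra_simps)
    then have "norm c * (r * norm c) \<le> norm c * ((M + K * C2) * \<eta>)" using L by simp
    then have "r * norm c \<le> (M + K * C2) * \<eta>"
      using M K C2 \<eta> by (cases "c = 0") auto
    then show "norm (uh t0 - u t0) \<le> C * \<eta>"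
      using r(1) by (simp add: C_def c_def field_simps)
  qed
qed

end

section \<open>Convergence as the mesh tends to zero\<close>

theorem theorem1:
  fixes a b :: real
    and qa qb :: "real ^ 'n"
    and S :: "real ^ 'n ^ 'n"
    and x \<omega> :: "real \<Rightarrow> real ^ 'n"
    and v :: "real \<Rightarrow> real ^ 'm"
    and A W :: "real \<Rightarrow> real ^ 'n ^ 'n"
    and B :: "real \<Rightarrow> real ^ 'm ^ 'n"
    and R :: "real \<Rightarrow> real ^ 'm ^ 'm"
    and u_opt :: "real \<Rightarrow> real ^ 'm"
    and u_samp :: "real list \<Rightarrow> real \<Rightarrow> real ^ 'm"
  assumes "a < b"
    and "sym_pos_semidef S"
    and "continuous_on {a..b} x"
    and "continuous_on {a..b} \<omega>"
    and "continuous_on {a..b} v"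
    and "continuous_on {a..b} A"
    and "continuous_on {a..b} B"
    and "continuous_on {a..b} W"
    and "continuous_on {a..b} R"
    and "\<And>t. t \<in> {a..b} \<Longrightarrow> sym_pos_semidef (W t)"
    and "\<And>t. t \<in> {a..b} \<Longrightarrow> sym_pos_def (R t)"
    and "is_arg_min (cost a b A B \<omega> qa qb S W R x v) (\<lambda>u. u \<in> L2_on a b) u_opt"
    and "continuous_on {a..b} u_opt"
    and "\<And>h. h \<in> partitions a b \<Longrightarrow>
           is_arg_min (cost a b A B \<omega> qa qb S W R x v) (\<lambda>u. u \<in> sampled_controls a h) (u_samp h)"
  shows "\<forall>t\<in>{a..<b}. \<forall>\<epsilon>>0. \<exists>\<delta>>0. \<forall>h\<in>partitions a b. mesh h < \<delta> \<longrightarrow>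
           norm (u_samp h t - u_opt t) < \<epsilon>"
proof (intro ballI allI impI)
  interpret lq_control a b A B qa qb S x \<omega> v W R
    by unfold_locales (use assms in auto)
  obtain C where C: "0 < C"
    "\<And>h uh \<eta> t. \<lbrakk>h \<in> partitions a b; is_arg_min J (\<lambda>u. u \<in> sampled_controls a h) uh; 0 < \<eta>;
        \<And>s t. s \<in> {a..b} \<Longrightarrow> t \<in> {a..b} \<Longrightarrow> \<bar>s - t\<bar> \<le> mesh h \<Longrightarrow> norm (u_opt s - u_opt t) \<le> \<eta>;
        t \<in> {a..<b}\<rbrakk> \<Longrightarrow> norm (uh t - u_opt t) \<le> C * \<eta>"
    using sampled_error_bound[OF assms(13,12)] by blast
  fix t \<epsilon> :: real assume t: "t \<in> {a..<b}" and \<epsilon>: "0 < \<epsilon>"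
  \<comment> \<open>The factor 2 gives \<open>C * \<eta> = \<epsilon> / 2\<close>, turning the weak
    error bound into a strict one.\<close>
  define \<eta> where "\<eta> = \<epsilon> / (2 * C)"
  have \<eta>: "0 < \<eta>" using \<epsilon> C(1) by (simp add: \<eta>_def)
  \<comment> \<open>A mesh below the modulus of uniform continuity for \<open>\<eta>\<close>
    supplies the oscillation hypothesis; the resulting \<open>\<delta>\<close> is the same for every
    \<open>t\<close>.\<close>
  have "uniformly_continuous_on {a..b} u_opt"
    by (rule compact_uniformly_continuous[OF assms(13)]) simp
  then obtain \<delta> where \<delta>: "0 < \<delta>"
    "\<And>s t. s \<in> {a..b} \<Longrightarrow> t \<in> {a..b} \<Longrightarrow> dist s t < \<delta> \<Longrightarrow> dist (u_opt s) (u_opt t) < \<eta>"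
    using \<eta> unfolding uniformly_continuous_on_def by metis
  have "norm (u_samp h t - u_opt t) < \<epsilon>" if h: "h \<in> partitions a b" "mesh h < \<delta>" for h
  proof -
    have "norm (u_samp h t - u_opt t) \<le> C * \<eta>"
    proof (rule C(2)[OF h(1) assms(14)[OF h(1)] \<eta> _ t])
      fix s t :: real assume "s \<in> {a..b}" "t \<in> {a..b}" "\<bar>s - t\<bar> \<le> mesh h"
      then show "norm (u_opt s - u_opt t) \<le> \<eta>"
        using \<delta>(2)[of s t] h(2) by (simp add: dist_norm dist_real_def)
    qed
    also have "\<dots> < \<epsilon>" using \<epsilon> C(1) by (simp add: \<eta>_def)
    finally show ?thesis .
  qed
  with \<delta>(1) show "\<exists>\<delta>>0. \<forall>h\<in>partitions a b. mesh h < \<delta> \<longrightarrow> norm (u_samp h t - u_opt t) < \<epsilon>"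
    by blast
qed

end
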